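(* Let $\ell:\mathbb{N}\to\mathbb{N}$ be a function for which there are $c>0$ and $n_0\in\mathbb{N}$ with $c\log n\le \ell(n)\le n/2$ for all $n\ge n_0$. Then there is no compact family of extended formulations for the polytopes $\mathrm{P}_{\mathrm{match}}^{\ell(n)}(n)$, $n\ge n_0$, in which each formulation is symmetric with respect to the group $\mathfrak{S}(n)$ acting by permuting the nodes of $K_n$.
   Context: $K_n=([n],E_n)$ is the complete graph on $[n]=\{1,\dots,n\}$. $\mathcal{M}^{\ell}(n)$ is the set of all matchings $M\subseteq E_n$ (sets of edges no two of which share a node) with $|M|=\ell$; $\chi(M)\in\{0,1\}^{E_n}$ is the characteristic vector of $M$; and $\mathrm{P}_{\mathrm{match}}^{\ell}(n)=\operatorname{conv}\{\chi(M): M\in\mathcal{M}^{\ell}(n)\}\subseteq\mathbb{R}^{E_n}$. The symmetric group $\mathfrak{S}(n)$ acts on $E_n$ by $\pi.\{v,w\}=\{\pi(v),\pi(w)\}$ and hence on $\mathbb{R}^{E_n}$ by $(\pi.x)_{\{v,w\}}=x_{\{\pi^{-1}(v),\pi^{-1}(w)\}}$; this action maps $\mathrm{P}_{\mathrm{match}}^{\ell}(n)$ to itself. An extension of a polytope $P\subseteq\mathbb{R}^m$ is a polyhedron $Q\subseteq\mathbb{R}^d$ together with an affine map $p:\mathbb{R}^d\to\mathbb{R}^m$ with $p(Q)=P$. An extended formulation for $P$ is a finite system of linear equations and inequalities whose solution set, together with some such map $p$, is an extension of $P$. Its size is its number of inequalities (including nonnegativity constraints, but not equations). Extended formulations for a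 family of polytopes $P\subseteq\mathbb{R}^m$ (varying $m$) are compact if their sizes and the encoding lengths of the coefficients needed to describe them are bounded by a polynomial in $m$ and the maximal encoding length of the components of the vertices of $P$. $\mathfrak{S}(d)$ acts on $\mathbb{R}^d$ by coordinate permutations, $(\sigma.y)_j=y_{\sigma^{-1}(j)}$. Let $G$ be a group of affine transformations $\pi$ of $\mathbb{R}^m$ with $\pi.P=P$. An extended formulation $A^{=}y=b^{=}$, $A^{\le}y\le b^{\le}$ of $P$ with solution set $Q\subseteq\mathbb{R}^d$ and projection $p$ is symmetric with respect to $G$ if for every $\pi\in G$ there are a permutation $\varkappa_\pi\in\mathfrak{S}(d)$ with $p(\varkappa_\pi.y)=\pi.p(y)$ for all $y\in Q$, and permutations $\varrho^{=}_\pi$, $\varrho^{\le}_\pi$ of the rows of $(A^{=},b^{=})$ and $(A^{\le},b^{\le})$, respectively, such that simultaneously permuting the columns of $A^{=}$ (resp. $A^{\le}$) by $\varkappa_\pi$ and the rows of $(A^{=},b^{=})$ by $\varrho^{=}_\pi$ (resp. of $(A^{\le},b^{\le})$ by $\varrho^{\le}_\pi$) leaves $(A^{=},b^{=})$ (resp. $(A^{\le},b^{\le})$) unchanged. *)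

theory Defs
  imports
    "HOL-Analysis.Analysis"
    "HOL-Library.Function_Algebras"
    "HOL-Combinatorics.Permutations"
    "HOL-Computational_Algebra.Polynomial"
    "Jordan_Normal_Form.Matrix"
begin

unbundle no vec_syntax and no inner_syntax

text \<open>
  For a finite set \<open>E\<close>, the space \<open>\<real>\<^sup>E\<close> is modelled by the functions on the whole index type
  that vanish outside \<open>E\<close>. Pointwise scaling makes functions a real vector space, so that
  \<^const>\<open>convex\<close>, \<^const>\<open>hull\<close> and \<^const>\<open>extreme_point_of\<close> apply to them.
\<close>

instantiation "fun" :: (type, real_vector) real_vector
begin

definition scaleR_fun :: "real \<Rightarrow> ('a \<Rightarrow> 'b) \<Rightarrow> 'a \<Rightarrow> 'b" where
  "scaleR_fun r f = (\<lambda>x. r *\<^sub>R f x)"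

instance
  by standard (simp_all add: scaleR_fun_def fun_eq_iff scaleR_add_left scaleR_add_right)

end


subsection \<open>Matching polytopes\<close>

definition edges :: "nat \<Rightarrow> nat set set" where
  "edges n = {e. e \<subseteq> {1..n} \<and> card e = 2}"

definition matchings :: "nat \<Rightarrow> nat \<Rightarrow> nat set set set" where
  "matchings l n = {M. M \<subseteq> edges n \<and> pairwise disjnt M \<and> card M = l}"

definition char_vec :: "'e set \<Rightarrow> 'e \<Rightarrow> real" where
  "char_vec M = indicator M"

definition match_polytope :: "nat \<Rightarrow> nat \<Rightarrow> (nat set \<Rightarrow> real) set" where
  "match_polytope l n = convex hull (char_vec ` matchings l n)"

text \<open>
  Inverses of permutations are written \<open>inv_into UNIV\<close>, because \<open>inv\<close> is group inversion in the
  presence of HOL-Algebra.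
\<close>

definition node_action :: "(nat \<Rightarrow> nat) \<Rightarrow> (nat set \<Rightarrow> real) \<Rightarrow> nat set \<Rightarrow> real" where
  "node_action \<pi> x = (\<lambda>e. x (inv_into UNIV \<pi> ` e))"

definition node_group :: "nat \<Rightarrow> ((nat set \<Rightarrow> real) \<Rightarrow> nat set \<Rightarrow> real) set" where
  "node_group n = node_action ` {\<pi>. \<pi> permutes {1..n}}"


subsection \<open>Extended formulations\<close>

text \<open>
  A system \<open>A\<^sup>= y = b\<^sup>=\<close>, \<open>A\<^sup>\<le> y \<le> b\<^sup>\<le>\<close> in \<open>\<real>\<^sup>d\<close>, together with an affine map
  \<open>\<real>\<^sup>d \<rightarrow> \<real>\<^sup>E\<close> whose coordinate \<open>e\<close> is \<open>y \<mapsto> proj_row e \<bullet> y + proj_const e\<close>. Nonnegativity constraints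
  are among the rows of \<open>A\<^sup>\<le>\<close>. Indices of rows and columns start at 0.
\<close>

record 'e formulation =
  nvars :: nat
  eq_mat :: "real mat"
  eq_rhs :: "real vec"
  le_mat :: "real mat"
  le_rhs :: "real vec"
  proj_row :: "'e \<Rightarrow> real vec"
  proj_const :: "'e \<Rightarrow> real"

definition well_formed :: "'e set \<Rightarrow> 'e formulation \<Rightarrow> bool" where
  "well_formed E F \<longleftrightarrow>
     eq_mat F \<in> carrier_mat (dim_vec (eq_rhs F)) (nvars F) \<and>
     le_mat F \<in> carrier_mat (dim_vec (le_rhs F)) (nvars F) \<and>
     (\<forall>e\<in>E. proj_row F e \<in> carrier_vec (nvars F))"

definition solutions :: "'e formulation \<Rightarrow> real vec set" where
  "solutions F =
     {y \<in> carrier_vec (nvars F). eq_mat F *\<^sub>v y = eq_rhs F \<and> le_mat F *\<^sub>v y \<le> le_rhs F}"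

definition projection :: "'e set \<Rightarrow> 'e formulation \<Rightarrow> real vec \<Rightarrow> 'e \<Rightarrow> real" where
  "projection E F y = (\<lambda>e. if e \<in> E then proj_row F e \<bullet> y + proj_const F e else 0)"

definition extended_formulation :: "'e set \<Rightarrow> ('e \<Rightarrow> real) set \<Rightarrow> 'e formulation \<Rightarrow> bool" where
  "extended_formulation E P F \<longleftrightarrow> well_formed E F \<and> projection E F ` solutions F = P"

definition form_size :: "'e formulation \<Rightarrow> nat" where
  "form_size F = dim_row (le_mat F)"

definition coefficients :: "'e set \<Rightarrow> 'e formulation \<Rightarrow> real set" where
  "coefficients E F =
     elements_mat (eq_mat F) \<union> vec_set (eq_rhs F) \<union>
     elements_mat (le_mat F) \<union> vec_set (le_rhs F) \<union>
     (\<Union>e\<in>E. vec_set (proj_row F e)) \<union> proj_const F ` E"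


subsection \<open>Symmetry\<close>

definition permute_vec :: "(nat \<Rightarrow> nat) \<Rightarrow> 'a vec \<Rightarrow> 'a vec" where
  "permute_vec \<sigma> v = vec (dim_vec v) (\<lambda>i. v $ inv_into UNIV \<sigma> i)"

definition permute_mat :: "(nat \<Rightarrow> nat) \<Rightarrow> (nat \<Rightarrow> nat) \<Rightarrow> 'a mat \<Rightarrow> 'a mat" where
  "permute_mat \<rho> \<sigma> A = mat (dim_row A) (dim_col A)
     (\<lambda>(i, j). A $$ (inv_into UNIV \<rho> i, inv_into UNIV \<sigma> j))"

text \<open>
  The notion is intended for a group \<open>G\<close> of affine maps of \<open>\<real>\<^sup>E\<close> that preserve the projected polytope,
  as \<^const>\<open>node_group\<close> does for \<^const>\<open>match_polytope\<close>. No homomorphism property of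
  \<open>\<kappa>\<close>, \<open>\<rho>eq\<close>, \<open>\<rho>le\<close> as functions of \<open>g\<close> is required.
\<close>

definition symmetric_formulation ::
    "'e set \<Rightarrow> (('e \<Rightarrow> real) \<Rightarrow> 'e \<Rightarrow> real) set \<Rightarrow> 'e formulation \<Rightarrow> bool" where
  "symmetric_formulation E G F \<longleftrightarrow>
     (\<forall>g\<in>G. \<exists>\<kappa> \<rho>eq \<rho>le.
        \<kappa> permutes {..<nvars F} \<and>
        \<rho>eq permutes {..<dim_row (eq_mat F)} \<and>
        \<rho>le permutes {..<dim_row (le_mat F)} \<and>
        (\<forall>y\<in>solutions F. projection E F (permute_vec \<kappa> y) = g (projection E F y)) \<and>
        permute_mat \<rho>eq \<kappa> (eq_mat F) = eq_mat F \<and> permute_vec \<rho>eq (eq_rhs F) = eq_rhs F \<and>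
        permute_mat \<rho>le \<kappa> (le_mat F) = le_mat F \<and> permute_vec \<rho>le (le_rhs F) = le_rhs F)"


subsection \<open>Compactness\<close>

text \<open>
  The binary encoding length \<open>1 + \<lceil>log\<^sub>2 (\<bar>p\<bar> + 1)\<rceil> + \<lceil>log\<^sub>2 (q + 1)\<rceil>\<close> of a rational number \<open>p / q\<close>
  in lowest terms. It is meaningful for arguments in \<^const>\<open>Rats\<close> only.
\<close>

definition encoding_length :: "real \<Rightarrow> nat" where
  "encoding_length x =
     (let (p, q) = quotient_of (THE r. of_rat r = x)
      in 1 + nat \<lceil>log 2 (\<bar>real_of_int p\<bar> + 1)\<rceil> + nat \<lceil>log 2 (real_of_int q + 1)\<rceil>)"

text \<open>The element 0 only matters if there are no components at all, i.e. if \<open>E = {}\<close> or \<open>P = {}\<close>.\<close>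

definition vertex_encoding_length :: "'e set \<Rightarrow> ('e \<Rightarrow> real) set \<Rightarrow> nat" where
  "vertex_encoding_length E P =
     Max (insert 0 {encoding_length (v e) | v e. v extreme_point_of P \<and> e \<in> E})"

text \<open>
  The bounding polynomial has two variables, namely the dimension of the space containing the
  polytope (outer variable) and the encoding length of its vertices (inner variable).
\<close>

definition compact_family ::
    "'i set \<Rightarrow> ('i \<Rightarrow> 'e set) \<Rightarrow> ('i \<Rightarrow> ('e \<Rightarrow> real) set) \<Rightarrow> ('i \<Rightarrow> 'e formulation) \<Rightarrow> bool" where
  "compact_family I E P F \<longleftrightarrow>
     (\<forall>i\<in>I. extended_formulation (E i) (P i) (F i)) \<and>
     (\<exists>q :: real poly poly. \<forall>i\<in>I.
        let B = poly (poly q [:real (card (E i)):]) (real (vertex_encoding_length (E i) (P i)))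
        in real (form_size (F i)) \<le> B \<and>
           (\<forall>a\<in>coefficients (E i) (F i). a \<in> \<rat> \<and> real (encoding_length a) \<le> B))"

end

theory Submission
  imports Defs "HOL-Real_Asymp.Real_Asymp"
begin

text \<open>
  Suppose that for all large \<open>n\<close> there is a symmetric formulation of size \<open>f \<le> n ^ k\<close>. Averaging over
  suitable finite sets of solutions gives a section of the projection that is equivariant, so each of
  the \<open>f\<close> slack functions on matchings has at most \<open>f\<close> images under node permutations. Its stabiliser
  therefore has index at most \<open>f\<close> and contains all even permutations that fix some \<open>k\<close> nodes \<open>W\<close>;
  hence its value at \<open>M\<close> depends only on the edges of \<open>M\<close> that meet \<open>W\<close>.

  Take disjoint node sets \<open>A\<close>, \<open>B\<close> of odd size \<open>2 k + 1\<close> and consider the perfect matchings of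
  \<open>A \<union> B\<close>, extended by a fixed matching elsewhere. The average of a slack function over those with \<open>x\<close>
  edges inside \<open>A\<close> is a polynomial in \<open>x\<close> of degree at most \<open>k\<close>, and its value at \<open>x = k + 1/2\<close> is
  still nonnegative. Lagrange interpolation turns this evaluation into an affine combination of
  section points, which is thus a solution of the formulation. Its projection would be a point of the
  polytope without any edge between \<open>A\<close> and \<open>B\<close>, which parity excludes.
\<close>

subsection \<open>Subgroups of small index in a symmetric group\<close>

text \<open>Symmetry supplies some row permutation for each node permutation, but these choices need
  not compose, so the rows carry no group action. The stabilisers are therefore those of functions
  on matchings, on which node permutations do act; row indices only serve to count images.
  Transpositions cannot be forced into a subgroup of small index, as the alternating group has index
  two, but 3-cycles can. The two size thresholds have separate origins: \<open>2 ^ Suc r\<close>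
  comes from counting products of disjoint transpositions and makes the alternating part cover all
  but \<open>6 * r\<close> nodes; \<open>n choose Suc k\<close> comes from counting the images of
  that part and leaves only \<open>k\<close> exceptional nodes. At most \<open>k\<close> edges of a
  matching meet these, which bounds the degree by \<open>k\<close>. Sides of
  \<open>2 * k + 1\<close> nodes allow the values \<open>0, ..., k\<close> for \<open>x\<close>,
  exactly the \<open>k + 1\<close> interpolation points that determine such a polynomial. At
  \<open>x = k + 1/2\<close> the inner edges would fill each side, with no node left over for a
  crossing edge.\<close>

definition cyc3 :: "'a \<Rightarrow> 'a \<Rightarrow> 'a \<Rightarrow> 'a \<Rightarrow> 'a" where
  "cyc3 a b c = Transposition.transpose a b \<circ> Transposition.transpose b c"

text \<open>The product of the commuting transpositions \<open>(a i b i)\<close> for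
  \<open>i \<in> S\<close>. The closed form avoids an order of composition; it has this meaning when
  \<open>a\<close> and \<open>b\<close> are injective with disjoint ranges, as in the context
  below.\<close>

definition swaps :: "('i \<Rightarrow> 'a) \<Rightarrow> ('i \<Rightarrow> 'a) \<Rightarrow> 'i set \<Rightarrow> 'a \<Rightarrow> 'a" where
  "swaps a b S x = (if x \<in> a ` S then b (inv_into S a x)
     else if x \<in> b ` S then a (inv_into S b x) else x)"

lemma cyc3_rotate:
  assumes "a \<noteq> b" "b \<noteq> c" "a \<noteq> c"
  shows "cyc3 a b c = cyc3 b c a"
  using assms by (auto simp: cyc3_def fun_eq_iff Transposition.transpose_def)

lemma bij_cyc3: "bij (cyc3 a b c)"
  unfolding cyc3_def by (intro bij_comp) auto

lemma inv_cyc3: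
  assumes "a \<noteq> b" "b \<noteq> c" "a \<noteq> c"
  shows "inv_into UNIV (cyc3 a b c) = cyc3 b a c"
proof (rule inv_equality)
  show "cyc3 b a c (cyc3 a b c x) = x" for x
    using assms by (auto simp: cyc3_def Transposition.transpose_def)
  show "cyc3 a b c (cyc3 b a c x) = x" for x
    using assms by (auto simp: cyc3_def Transposition.transpose_def)
qed

lemma cyc3_conj:
  assumes "bij \<pi>"
  shows "\<pi> \<circ> cyc3 a b c \<circ> inv_into UNIV \<pi> = cyc3 (\<pi> a) (\<pi> b) (\<pi> c)"
proof
  fix x
  obtain y where y: "x = \<pi> y" using assms by (metis bij_pointE)
  have inj: "\<pi> u = \<pi> v \<longleftrightarrow> u = v" for u v using assms by (meson bij_is_inj injD)
  have "inv_into UNIV \<pi> x = y" using y assms by (simp add: bij_is_inj)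
  then show "(\<pi> \<circ> cyc3 a b c \<circ> inv_into UNIV \<pi>) x = cyc3 (\<pi> a) (\<pi> b) (\<pi> c) x"
    by (auto simp: cyc3_def Transposition.transpose_def inj y)
qed

context
  fixes a b :: "'i \<Rightarrow> 'a" and I :: "'i set"
  assumes inj_a: "inj_on a I" and inj_b: "inj_on b I" and ab: "a ` I \<inter> b ` I = {}"
begin

lemma swaps_left: "S \<subseteq> I \<Longrightarrow> i \<in> I \<Longrightarrow> swaps a b S (a i) = (if i \<in> S then b i else a i)"
  using inj_on_subset[OF inj_a, of S] ab inj_on_image_mem_iff[OF inj_a, of i S]
  by (auto simp: swaps_def)

lemma swaps_right:
  assumes "S \<subseteq> I" "i \<in> I" shows "swaps a b S (b i) = (if i \<in> S then a i else b i)"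
proof -
  have "b i \<notin> a ` S" using ab assms by blast
  then show ?thesis
    using inj_on_subset[OF inj_b, of S] inj_on_image_mem_iff[OF inj_b, of i S] assms
    by (auto simp: swaps_def)
qed

lemma swaps_other: "S \<subseteq> I \<Longrightarrow> x \<notin> a ` S \<Longrightarrow> x \<notin> b ` S \<Longrightarrow> swaps a b S x = x"
  by (auto simp: swaps_def)

text \<open>Indices common to both sets are swapped twice, so composition is addition over the
  two-element field. Together with \<open>inv_swaps\<close> this is the rule that
  \<open>few_independent\<close> asks of \<open>\<tau>\<close>.\<close>

lemma swaps_comp:
  assumes "S \<subseteq> I" "S' \<subseteq> I"
  shows "swaps a b S \<circ> swaps a b S' = swaps a b (sym_diff S S')"
proof
  fix x
  have D: "sym_diff S S' \<subseteq> I" using assms by blast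
  consider i where "i \<in> I" "x = a i" | i where "i \<in> I" "x = b i" | "x \<notin> a ` I" "x \<notin> b ` I" by blast
  then show "(swaps a b S \<circ> swaps a b S') x = swaps a b (sym_diff S S') x"
  proof cases
    case 1 then show ?thesis using assms D by (auto simp: swaps_left swaps_right)
  next
    case 2 then show ?thesis using assms D by (auto simp: swaps_left swaps_right)
  next
    case 3
    then have "swaps a b T x = x" if "T \<subseteq> I" for T
      using that by (intro swaps_other) auto
    then show ?thesis using assms D by auto
  qed
qed

lemma swaps_invol: "S \<subseteq> I \<Longrightarrow> swaps a b S \<circ> swaps a b S = id"
  by (subst swaps_comp) (auto simp: swaps_def fun_eq_iff)

lemma inv_swaps: "S \<subseteq> I \<Longrightarrow> inv_into UNIV (swaps a b S) = swaps a b S"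
  using swaps_invol[of S] by (intro inv_equality) (auto simp: fun_eq_iff)

lemma swaps_permutes:
  assumes "S \<subseteq> I" "a ` I \<subseteq> V" "b ` I \<subseteq> V"
  shows "swaps a b S permutes V"
proof -
  have "bij (swaps a b S)" using swaps_invol[OF assms(1)] o_bij by blast
  moreover have "swaps a b S x = x" if "x \<notin> V" for x
    using that assms by (intro swaps_other) auto
  ultimately show ?thesis by (simp add: permutes_def bij_iff)
qed

end

section \<open>Permutation groups with few cosets\<close>

text \<open>The index bound is encoded by a labelling with \<open>f\<close> labels: permutations
  with equal labels lie in a common left coset of \<open>U\<close>. One coset may carry several
  labels, which suits labels that arise from arbitrarily chosen row permutations.\<close>

locale small_index_subgroup =
  fixes V :: "'a set" and U :: "('a \<Rightarrow> 'a) set" and f :: nat and coset :: "('a \<Rightarrow> 'a) \<Rightarrow> nat"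
  assumes finite_V: "finite V"
    and U_permutes: "\<pi> \<in> U \<Longrightarrow> \<pi> permutes V"
    and U_comp: "\<pi> \<in> U \<Longrightarrow> \<sigma> \<in> U \<Longrightarrow> \<pi> \<circ> \<sigma> \<in> U"
    and U_inv: "\<pi> \<in> U \<Longrightarrow> inv_into UNIV \<pi> \<in> U"
    and coset_less: "\<pi> permutes V \<Longrightarrow> coset \<pi> < f"
    and coset_eq: "\<pi> permutes V \<Longrightarrow> \<sigma> permutes V \<Longrightarrow> coset \<pi> = coset \<sigma> \<Longrightarrow> inv_into UNIV \<pi> \<circ> \<sigma> \<in> U"
begin

lemma U_conj: "\<pi> \<in> U \<Longrightarrow> \<sigma> \<in> U \<Longrightarrow> \<pi> \<circ> \<sigma> \<circ> inv_into UNIV \<pi> \<in> U"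
  by (intro U_comp U_inv)

text \<open>The 3-cycles on \<open>D\<close> generate its alternating group; naming the generators
  avoids signs and generated subgroups.\<close>

definition alternating_on :: "'a set \<Rightarrow> bool" where
  "alternating_on D \<longleftrightarrow> (\<forall>a\<in>D. \<forall>b\<in>D. \<forall>c\<in>D. a \<noteq> b \<longrightarrow> b \<noteq> c \<longrightarrow> a \<noteq> c \<longrightarrow> cyc3 a b c \<in> U)"

lemma alternating_onD:
  "alternating_on D \<Longrightarrow> a \<in> D \<Longrightarrow> b \<in> D \<Longrightarrow> c \<in> D \<Longrightarrow> a \<noteq> b \<Longrightarrow> b \<noteq> c \<Longrightarrow> a \<noteq> c \<Longrightarrow> cyc3 a b c \<in> U"
  by (auto simp: alternating_on_def)

text \<open>
  The elements \<open>\<tau> S\<close> behave like vectors over the two-element field. A maximal set \<open>J\<close> whose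
  nonempty subsets all stay outside \<open>U\<close> indexes an independent set of cosets, so it has at most
  \<open>log\<^sub>2 f\<close> elements.
\<close>
lemma few_independent:
  assumes "finite I" and f: "f < 2 ^ Suc r"
    and perm: "\<And>S. S \<subseteq> I \<Longrightarrow> \<tau> S permutes V"
    and diff: "\<And>S S'. S \<subseteq> I \<Longrightarrow> S' \<subseteq> I \<Longrightarrow> inv_into UNIV (\<tau> S) \<circ> \<tau> S' = \<tau> (sym_diff S S')"
  shows "\<exists>J\<subseteq>I. card J \<le> r \<and> (\<forall>i\<in>I - J. \<exists>S\<subseteq>J. \<tau> (insert i S) \<in> U)"
proof -
  define ind where "ind J \<longleftrightarrow> J \<subseteq> I \<and> (\<forall>T\<subseteq>J. T \<noteq> {} \<longrightarrow> \<tau> T \<notin> U)" for J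
  have "ind {}" by (simp add: ind_def)
  moreover have "finite {J. ind J}"
    by (rule finite_subset[of _ "Pow I"]) (auto simp: ind_def assms(1))
  ultimately obtain J where J: "ind J" and max: "\<And>J'. ind J' \<Longrightarrow> J \<subseteq> J' \<Longrightarrow> J' = J"
    using finite_has_maximal[of "{J. ind J}"] by blast
  have JI: "J \<subseteq> I" using J by (simp add: ind_def)
  \<comment> \<open>Two subsets of \<open>J\<close> in one coset would put \<open>\<tau>\<close> of
    their symmetric difference, a nonempty subset of \<open>J\<close>, into
    \<open>U\<close>.\<close>
  have "inj_on (coset \<circ> \<tau>) (Pow J)"
  proof (rule inj_onI, rule ccontr)
    fix S S' assume S: "S \<in> Pow J" "S' \<in> Pow J" "(coset \<circ> \<tau>) S = (coset \<circ> \<tau>) S'" "S \<noteq> S'"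
    then have "\<tau> (sym_diff S S') \<in> U"
      using coset_eq[of "\<tau> S" "\<tau> S'"] diff[of S S'] perm JI by auto
    moreover have "sym_diff S S' \<subseteq> J" "sym_diff S S' \<noteq> {}" using S by auto
    ultimately show False using J by (simp add: ind_def)
  qed
  moreover have "(coset \<circ> \<tau>) ` Pow J \<subseteq> {..<f}"
    using coset_less perm JI by auto
  ultimately have "card (Pow J) \<le> f"
    using card_inj_on_le[of _ "Pow J" "{..<f}"] by auto
  then have "2 ^ card J \<le> f" using finite_subset[OF JI assms(1)] by (simp add: card_Pow)
  with f have "(2::nat) ^ card J < 2 ^ Suc r" by linarith
  then have "card J \<le> r" by (simp only: power_strict_increasing_iff)
  moreover have "\<exists>S\<subseteq>J. \<tau> (insert i S) \<in> U" if "i \<in> I - J" for i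
  proof -
    have i: "i \<in> I" "i \<notin> J" using that by auto
    then have "\<not> ind (insert i J)" using max[of "insert i J"] by blast
    then obtain T where T: "T \<subseteq> insert i J" "T \<noteq> {}" "\<tau> T \<in> U"
      using i JI by (auto simp: ind_def)
    then have "i \<in> T" using J by (auto simp: ind_def)
    then show ?thesis using T by (intro exI[of _ "T - {i}"]) (auto simp: insert_absorb)
  qed
  ultimately show ?thesis using JI by blast
qed

text \<open>
  Two elements of \<open>U\<close> whose supports share a single point have a 3-cycle as commutator.
  They are found among products of the transpositions \<open>(a i b i)\<close> and \<open>(b i c i)\<close>, respectively.
\<close>
lemma few_bad_triples:
  fixes a b c :: "'i \<Rightarrow> 'a"
  assumes "finite I" and f: "f < 2 ^ Suc r"
    and inj: "inj_on a I" "inj_on b I" "inj_on c I"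
    and disj: "a ` I \<inter> b ` I = {}" "b ` I \<inter> c ` I = {}" "a ` I \<inter> c ` I = {}"
    and V: "a ` I \<subseteq> V" "b ` I \<subseteq> V" "c ` I \<subseteq> V"
    and bad: "\<And>i. i \<in> I \<Longrightarrow> cyc3 (a i) (c i) (b i) \<notin> U"
  shows "card I \<le> 2 * r"
proof -
  have "\<exists>J\<subseteq>I. card J \<le> r \<and> (\<forall>i\<in>I - J. \<exists>S\<subseteq>J. swaps a b (insert i S) \<in> U)"
  proof (rule few_independent[OF \<open>finite I\<close> f, of "swaps a b"])
    show "swaps a b S permutes V" if "S \<subseteq> I" for S
      using swaps_permutes[OF inj(1,2) disj(1) that V(1,2)] .
    show "inv_into UNIV (swaps a b S) \<circ> swaps a b S' = swaps a b (sym_diff S S')"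
      if "S \<subseteq> I" "S' \<subseteq> I" for S S'
      using inv_swaps[OF inj(1,2) disj(1)] swaps_comp[OF inj(1,2) disj(1)] that by simp
  qed
  then obtain J1 where J1: "J1 \<subseteq> I" "card J1 \<le> r"
    and S1: "\<And>i. i \<in> I - J1 \<Longrightarrow> \<exists>S\<subseteq>J1. swaps a b (insert i S) \<in> U" by blast
  \<comment> \<open>Dropping \<open>J1\<close> before the second selection keeps the index sets
    \<open>T1\<close> and \<open>T2\<close> below disjoint, so that the supports of the two products
    meet in \<open>b i\<close> only.\<close>
  define I' where "I' = I - J1"
  have I': "I' \<subseteq> I" "finite I'" using \<open>finite I\<close> by (auto simp: I'_def)
  have inj': "inj_on b I'" "inj_on c I'" using inj_on_subset[OF _ I'(1)] inj by auto
  have disj': "b ` I' \<inter> c ` I' = {}"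
    using Int_mono[OF image_mono[OF I'(1), of b] image_mono[OF I'(1), of c]] disj(2) by simp
  have V': "b ` I' \<subseteq> V" "c ` I' \<subseteq> V"
    using image_mono[OF I'(1), of b] image_mono[OF I'(1), of c] V(2,3) by simp_all
  have "\<exists>J\<subseteq>I'. card J \<le> r \<and> (\<forall>i\<in>I' - J. \<exists>S\<subseteq>J. swaps b c (insert i S) \<in> U)"
  proof (rule few_independent[OF I'(2) f, of "swaps b c"])
    show "swaps b c S permutes V" if "S \<subseteq> I'" for S
      using swaps_permutes[OF inj' disj' that V'] .
    show "inv_into UNIV (swaps b c S) \<circ> swaps b c S' = swaps b c (sym_diff S S')"
      if "S \<subseteq> I'" "S' \<subseteq> I'" for S S'
      using inv_swaps[OF inj' disj'] swaps_comp[OF inj' disj'] that by simp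
  qed
  then obtain J2 where J2: "J2 \<subseteq> I'" "card J2 \<le> r"
    and S2: "\<And>i. i \<in> I' - J2 \<Longrightarrow> \<exists>S\<subseteq>J2. swaps b c (insert i S) \<in> U" by blast
  have "I \<subseteq> J1 \<union> J2"
  proof (rule ccontr)
    assume "\<not> I \<subseteq> J1 \<union> J2"
    then obtain i where i: "i \<in> I" "i \<notin> J1" "i \<notin> J2" by blast
    obtain T1 where T1: "T1 \<subseteq> J1" "swaps a b (insert i T1) \<in> U" using S1 i by blast
    obtain T2 where T2: "T2 \<subseteq> J2" "swaps b c (insert i T2) \<in> U" using S2 i by (auto simp: I'_def)
    let ?\<sigma> = "swaps a b (insert i T1)" and ?\<tau> = "swaps b c (insert i T2)"
    have sub: "insert i T1 \<subseteq> I" "insert i T2 \<subseteq> I" using T1 T2 J1 J2 I' i by auto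
    have T12: "j \<notin> T2" if "j \<in> T1" for j using that T1 T2 J2 by (auto simp: I'_def)
    have iT: "i \<notin> T1" "i \<notin> T2" using T1 T2 i by auto
    note \<sigma>a = swaps_left[OF inj(1,2) disj(1) sub(1)]
    note \<sigma>b = swaps_right[OF inj(1,2) disj(1) sub(1)]
    note \<sigma>o = swaps_other[OF inj(1,2) disj(1) sub(1)]
    note \<tau>b = swaps_left[OF inj(2,3) disj(2) sub(2)]
    note \<tau>c = swaps_right[OF inj(2,3) disj(2) sub(2)]
    note \<tau>o = swaps_other[OF inj(2,3) disj(2) sub(2)]
    have \<tau>a: "?\<tau> (a j) = a j" if "j \<in> I" for j
      using that sub disj by (intro \<tau>o) blast+
    have \<sigma>c: "?\<sigma> (c j) = c j" if "j \<in> I" for j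
      using that sub disj by (intro \<sigma>o) blast+
    have inj_eq: "a j = a i \<longleftrightarrow> j = i" "b j = b i \<longleftrightarrow> j = i" "c j = c i \<longleftrightarrow> j = i" if "j \<in> I" for j
      using that i inj by (meson inj_onD)+
    have ne: "a j \<noteq> b l" "b j \<noteq> a l" "b j \<noteq> c l" "c j \<noteq> b l" "a j \<noteq> c l" "c j \<noteq> a l"
      if "j \<in> I" "l \<in> I" for j l
      using that disj by blast+
    \<comment> \<open>Both factors are involutions, so the square of their product is their
      commutator. Pairs with an index other than \<open>i\<close> are moved by one factor only and
      return to their places.\<close>
    have "(?\<sigma> \<circ> ?\<tau>) \<circ> (?\<sigma> \<circ> ?\<tau>) = cyc3 (a i) (c i) (b i)"
    proof
      fix x
      consider j where "j \<in> I" "x = a j" | j where "j \<in> I" "x = b j" | j where "j \<in> I" "x = c j"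
        | "x \<notin> a ` I" "x \<notin> b ` I" "x \<notin> c ` I" by blast
      then show "((?\<sigma> \<circ> ?\<tau>) \<circ> (?\<sigma> \<circ> ?\<tau>)) x = cyc3 (a i) (c i) (b i) x"
      proof cases
        case 1
        then show ?thesis using T12[of j] iT i
          by (auto simp: \<sigma>a \<sigma>b \<sigma>c \<tau>a \<tau>b \<tau>c cyc3_def Transposition.transpose_def inj_eq ne)
      next
        case 2
        then show ?thesis using T12[of j] iT i
          by (auto simp: \<sigma>a \<sigma>b \<sigma>c \<tau>a \<tau>b \<tau>c cyc3_def Transposition.transpose_def inj_eq ne)
      next
        case 3
        then show ?thesis using T12[of j] iT i
          by (auto simp: \<sigma>a \<sigma>b \<sigma>c \<tau>a \<tau>b \<tau>c cyc3_def Transposition.transpose_def inj_eq ne)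
      next
        case 4
        then have "?\<sigma> x = x" "?\<tau> x = x" using sub by (auto intro!: \<sigma>o \<tau>o)
        moreover have "x \<noteq> a i" "x \<noteq> b i" "x \<noteq> c i" using 4 i by auto
        ultimately show ?thesis by (simp add: cyc3_def Transposition.transpose_def)
      qed
    qed
    then show False using bad[OF i(1)] T1(2) T2(2) U_comp by metis
  qed
  then have "card I \<le> card (J1 \<union> J2)"
    using J1 J2 I' \<open>finite I\<close> by (intro card_mono) (auto intro: finite_subset)
  then show ?thesis using card_Un_le[of J1 J2] J1 J2 by linarith
qed

text \<open>A maximal family of pairwise disjoint triples whose 3-cycles avoid \<open>U\<close> has
  at most \<open>2 * r\<close> members by \<open>few_bad_triples\<close> and hence covers at most
  \<open>6 * r\<close> points. A further such triple among the remaining points would extend the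
  family.\<close>

lemma large_alternating:
  assumes "f < 2 ^ Suc r"
  obtains D where "D \<subseteq> V" "card V \<le> card D + 6 * r" "alternating_on D"
proof -
  define pts :: "'a \<times> 'a \<times> 'a \<Rightarrow> 'a set" where "pts = (\<lambda>(a, b, c). {a, b, c})"
  define fam where "fam T \<longleftrightarrow> T \<subseteq> V \<times> V \<times> V \<and>
    (\<forall>(a, b, c)\<in>T. a \<noteq> b \<and> b \<noteq> c \<and> a \<noteq> c \<and> cyc3 a b c \<notin> U) \<and>
    (\<forall>s\<in>T. \<forall>t\<in>T. s \<noteq> t \<longrightarrow> pts s \<inter> pts t = {})" for T
  have "fam {}" by (simp add: fam_def)
  moreover have "finite {T. fam T}"
    by (rule finite_subset[of _ "Pow (V \<times> V \<times> V)"]) (auto simp: fam_def finite_V)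
  ultimately obtain T where T: "fam T" and max: "\<And>T'. fam T' \<Longrightarrow> T \<subseteq> T' \<Longrightarrow> T' = T"
    using finite_has_maximal[of "{T. fam T}"] by blast
  define X where "X = \<Union> (pts ` T)"
  have TV: "T \<subseteq> V \<times> V \<times> V" using T by (simp add: fam_def)
  then have finT: "finite T" using finite_V by (meson finite_SigmaI finite_subset)
  have pd: "s = t" if "s \<in> T" "t \<in> T" "x \<in> pts s" "x \<in> pts t" for s t x
    using T that unfolding fam_def by blast
  have dist: "fst t \<noteq> fst (snd t)" "fst (snd t) \<noteq> snd (snd t)" "fst t \<noteq> snd (snd t)"
    "cyc3 (fst t) (fst (snd t)) (snd (snd t)) \<notin> U" if "t \<in> T" for t
    using T that unfolding fam_def by auto
  have mem: "fst t \<in> pts t" "fst (snd t) \<in> pts t" "snd (snd t) \<in> pts t" for t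
    by (auto simp: pts_def split: prod.splits)
  have "card T \<le> 2 * r"
  \<comment> \<open>The commutator is the cycle \<open>(a c b)\<close>, with the shared point last;
    so \<open>b\<close> is the third component of a triple and \<open>c\<close> the second.\<close>
  proof (rule few_bad_triples[OF finT assms, where a = fst and b = "snd \<circ> snd" and c = "fst \<circ> snd"])
    have "s = t" if "s \<in> T" "t \<in> T" "fst s = fst t \<or> snd (snd s) = snd (snd t) \<or> fst (snd s) = fst (snd t)"
      for s t
      using that(3) mem[of s] mem[of t] pd[OF that(1,2)] by (elim disjE) auto
    then show "inj_on fst T" "inj_on (snd \<circ> snd) T" "inj_on (fst \<circ> snd) T"
      unfolding inj_on_def comp_apply by blast+
    have ne: "fst s \<noteq> snd (snd t)" "snd (snd s) \<noteq> fst (snd t)" "fst s \<noteq> fst (snd t)"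
      if "s \<in> T" "t \<in> T" for s t
    proof -
      have "s = t" if "x \<in> pts s" "x \<in> pts t" for x using pd \<open>s \<in> T\<close> \<open>t \<in> T\<close> that by blast
      then have "s = t" if "\<not> pts s \<inter> pts t = {}" using that by blast
      then show "fst s \<noteq> snd (snd t)" "snd (snd s) \<noteq> fst (snd t)" "fst s \<noteq> fst (snd t)"
        using mem[of s] mem[of t] dist[OF that(1)] by (metis disjoint_iff)+
    qed
    show "fst ` T \<inter> (snd \<circ> snd) ` T = {}" using ne(1) by (auto simp: disjoint_iff image_iff)
    show "(snd \<circ> snd) ` T \<inter> (fst \<circ> snd) ` T = {}" using ne(2) by (auto simp: disjoint_iff image_iff)
    show "fst ` T \<inter> (fst \<circ> snd) ` T = {}" using ne(3) by (auto simp: disjoint_iff image_iff)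
    show "fst ` T \<subseteq> V" "(snd \<circ> snd) ` T \<subseteq> V" "(fst \<circ> snd) ` T \<subseteq> V" using TV by auto
    show "cyc3 (fst t) ((fst \<circ> snd) t) ((snd \<circ> snd) t) \<notin> U" if "t \<in> T" for t
      using dist that by simp
  qed
  moreover have "card X \<le> (\<Sum>t\<in>T. card (pts t))"
    unfolding X_def by (rule card_UN_le[OF finT])
  moreover have "(\<Sum>t\<in>T. card (pts t)) \<le> (\<Sum>t\<in>T. 3)"
    by (intro sum_mono) (auto simp: pts_def card_insert_if split: prod.splits)
  ultimately have "card X \<le> 6 * r" by simp
  moreover have "card V \<le> card (V - X) + card X"
  proof -
    have "finite X" using finT by (auto simp: X_def pts_def)
    then have "card V \<le> card ((V - X) \<union> X)" using finite_V by (intro card_mono) auto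
    then show ?thesis using card_Un_le[of "V - X" X] by linarith
  qed
  moreover have "alternating_on (V - X)"
    unfolding alternating_on_def
  proof (intro ballI impI, rule ccontr)
    fix a b c assume *: "a \<in> V - X" "b \<in> V - X" "c \<in> V - X" "a \<noteq> b" "b \<noteq> c" "a \<noteq> c" "cyc3 a b c \<notin> U"
    have "pts (a, b, c) \<inter> X = {}" using * by (auto simp: pts_def)
    then have "pts (a, b, c) \<inter> pts t = {}" if "t \<in> T" for t using that by (auto simp: X_def)
    then have "fam (insert (a, b, c) T)"
      using T * unfolding fam_def by (auto simp: Int_commute)
    then have "(a, b, c) \<in> T" using max by blast
    then show False using * by (auto simp: X_def pts_def)
  qed
  ultimately show ?thesis using that[of "V - X"] by auto
qed

text \<open>The 3-cycles through two fixed points \<open>u\<close>, \<open>v\<close> generate all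
  others: conjugating them by each other yields the cycles through only one of \<open>u\<close>,
  \<open>v\<close>, and conjugating once more those through neither. The final case distinction runs
  over the positions of \<open>u\<close> and \<open>v\<close> in the cycle, up to rotation.\<close>

lemma alternating_onI:
  assumes uv: "u \<noteq> v" and base: "\<And>x. x \<in> D \<Longrightarrow> x \<noteq> u \<Longrightarrow> x \<noteq> v \<Longrightarrow> cyc3 u v x \<in> U"
  shows "alternating_on D"
proof -
  have ev: "cyc3 u v x u = v" "cyc3 u v x v = x" "cyc3 u v x x = u" if "x \<noteq> u" "x \<noteq> v" for x
    using that uv by (auto simp: cyc3_def Transposition.transpose_def)
  have fixed: "cyc3 a b c x = x" if "x \<noteq> a" "x \<noteq> b" "x \<noteq> c" for a b c x
    using that by (auto simp: cyc3_def Transposition.transpose_def)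
  have base': "cyc3 v u x \<in> U" if "x \<in> D" "x \<noteq> u" "x \<noteq> v" for x
    using U_inv[OF base[OF that]] inv_cyc3[of u v x] uv that by auto
  have ev': "cyc3 v u x u = x" "cyc3 v u x v = u" "cyc3 v u x x = v" if "x \<noteq> u" "x \<noteq> v" for x
    using that uv by (auto simp: cyc3_def Transposition.transpose_def)
  have v: "cyc3 v y x \<in> U" if "x \<in> D" "y \<in> D" "x \<noteq> u" "x \<noteq> v" "y \<noteq> u" "y \<noteq> v" "x \<noteq> y" for x y
    using U_conj[OF base[of y] base[of x]] that by (simp add: cyc3_conj bij_cyc3 ev fixed)
  have u: "cyc3 y u x \<in> U" if "x \<in> D" "y \<in> D" "x \<noteq> u" "x \<noteq> v" "y \<noteq> u" "y \<noteq> v" "x \<noteq> y" for x y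
    using U_conj[OF base'[of y] base[of x]] that by (simp add: cyc3_conj bij_cyc3 ev' fixed)
  have w: "cyc3 x y z \<in> U"
    if "x \<in> D" "y \<in> D" "z \<in> D" "x \<noteq> y" "y \<noteq> z" "x \<noteq> z" "x \<notin> {u, v}" "y \<notin> {u, v}" "z \<notin> {u, v}" for x y z
  proof -
    have "cyc3 y z x \<in> U"
      using U_conj[OF base'[of z] u[of x y]] that by (simp add: cyc3_conj bij_cyc3 ev' fixed)
    then show ?thesis using cyc3_rotate that by metis
  qed
  show ?thesis
    unfolding alternating_on_def
  proof (intro ballI impI)
    fix a b c assume D: "a \<in> D" "b \<in> D" "c \<in> D" and ne: "a \<noteq> b" "b \<noteq> c" "a \<noteq> c"
    have rot: "cyc3 b c a \<in> U \<Longrightarrow> cyc3 a b c \<in> U" "cyc3 c a b \<in> U \<Longrightarrow> cyc3 a b c \<in> U"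
      using cyc3_rotate[of a b c] cyc3_rotate[of c a b] ne by auto
    consider "a \<notin> {u, v}" "b \<notin> {u, v}" "c \<notin> {u, v}"
      | "a = u" "b = v" | "b = u" "c = v" | "c = u" "a = v"
      | "a = v" "b = u" | "b = v" "c = u" | "c = v" "a = u"
      | "a = u" "b \<noteq> v" "c \<noteq> v" | "b = u" "a \<noteq> v" "c \<noteq> v" | "c = u" "b \<noteq> v" "a \<noteq> v"
      | "a = v" "b \<noteq> u" "c \<noteq> u" | "b = v" "a \<noteq> u" "c \<noteq> u" | "c = v" "b \<noteq> u" "a \<noteq> u"
      by blast
    then show "cyc3 a b c \<in> U"
    proof cases
      case 1 then show ?thesis using w D ne by simp
    next
      case 2 then show ?thesis using base[of c] D ne by simp
    next
      case 3 then show ?thesis using base[of a] D ne by (intro rot(1)) simp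
    next
      case 4 then show ?thesis using base[of b] D ne by (intro rot(2)) simp
    next
      case 5 then show ?thesis using base'[of c] D ne by simp
    next
      case 6 then show ?thesis using base'[of a] D ne by (intro rot(1)) simp
    next
      case 7 then show ?thesis using base'[of b] D ne by (intro rot(2)) simp
    next
      case 8 then show ?thesis using u[of b c] D ne by (intro rot(2)) simp
    next
      case 9 then show ?thesis using u[of c a] D ne by simp
    next
      case 10 then show ?thesis using u[of a b] D ne by (intro rot(1)) simp
    next
      case 11 then show ?thesis using v[of c b] D ne by simp
    next
      case 12 then show ?thesis using v[of a c] D ne by (intro rot(1)) simp
    next
      case 13 then show ?thesis using v[of b a] D ne by (intro rot(2)) simp
    qed
  qed
qed

lemma alternating_on_image:
  assumes "alternating_on D" "\<pi> \<in> U"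
  shows "alternating_on (\<pi> ` D)"
  unfolding alternating_on_def
proof clarify
  fix a b c assume "a \<in> D" "b \<in> D" "c \<in> D" "\<pi> a \<noteq> \<pi> b" "\<pi> b \<noteq> \<pi> c" "\<pi> a \<noteq> \<pi> c"
  then have "\<pi> \<circ> cyc3 a b c \<circ> inv_into UNIV \<pi> \<in> U"
    using assms alternating_onD U_conj by metis
  then show "cyc3 (\<pi> a) (\<pi> b) (\<pi> c) \<in> U"
    using cyc3_conj permutes_bij[OF U_permutes[OF assms(2)]] by metis
qed

text \<open>Two common points serve as base \<open>u\<close>, \<open>v\<close>: any third point lies
  together with both of them in \<open>D\<close> or in \<open>D'\<close>.\<close>

lemma alternating_on_Un:
  assumes "alternating_on D" "alternating_on D'" "card (D \<inter> D') \<ge> 2"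
  shows "alternating_on (D \<union> D')"
proof -
  obtain S where "S \<subseteq> D \<inter> D'" "card S = 2" using assms(3) by (metis obtain_subset_with_card_n)
  then obtain u v where "u \<in> D \<inter> D'" "v \<in> D \<inter> D'" "u \<noteq> v" by (auto simp: card_2_iff)
  then show ?thesis
    using assms(1,2) by (intro alternating_onI[of u v]) (auto simp: alternating_on_def)
qed

text \<open>
  A maximal \<open>D\<close> on which \<open>U\<close> is alternating is moved by \<open>U\<close> only to itself, so that the images of
  \<open>D\<close> under all permutations belong to pairwise different cosets.
\<close>
theorem alternating_off_few_points:
  assumes f: "f < 2 ^ Suc r" and large: "12 * r + 2 \<le> card V" and few: "f < card V choose Suc k"
  obtains D where "D \<subseteq> V" "card (V - D) \<le> k" "alternating_on D"
proof -
  define n where "n = card V"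
  let ?fam = "{D. D \<subseteq> V \<and> card V \<le> card D + 6 * r \<and> alternating_on D}"
  have "finite ?fam" by (rule finite_subset[of _ "Pow V"]) (auto simp: finite_V)
  moreover obtain D0 where "D0 \<in> ?fam" using large_alternating[OF f] by (metis (mono_tags, lifting) mem_Collect_eq)
  then have "?fam \<noteq> {}" by blast
  ultimately obtain D where D: "D \<subseteq> V" "n \<le> card D + 6 * r" "alternating_on D"
    and max: "\<And>D'. D' \<subseteq> V \<Longrightarrow> n \<le> card D' + 6 * r \<Longrightarrow> alternating_on D' \<Longrightarrow> D \<subseteq> D' \<Longrightarrow> D' = D"
    using finite_has_maximal[of ?fam] unfolding n_def by (smt (verit) mem_Collect_eq)
  have finD: "finite D" using D(1) finite_V finite_subset by blast
  have stable: "\<pi> ` D = D" if "\<pi> \<in> U" for \<pi>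
  proof -
    have pV: "\<pi> permutes V" using that U_permutes by blast
    then have sub: "\<pi> ` D \<subseteq> V" using D(1) permutes_image by blast
    have card: "card (\<pi> ` D) = card D"
      using pV by (intro card_image) (meson inj_on_subset permutes_inj subset_UNIV)
    have "card (D \<union> \<pi> ` D) + card (D \<inter> \<pi> ` D) = 2 * card D"
      using card_Un_Int[OF finD, of "\<pi> ` D"] finD card by simp
    moreover have "card (D \<union> \<pi> ` D) \<le> n"
      unfolding n_def using D sub finite_V by (intro card_mono) auto
    \<comment> \<open>The overlap has at least
      \<open>2 * card D - n \<ge> n - 12 * r \<ge> 2\<close> points; this is the origin of the
      constants in \<open>large\<close>.\<close>
    ultimately have "card (D \<inter> \<pi> ` D) \<ge> 2" using D(2) large n_def by linarith
    then have "alternating_on (D \<union> \<pi> ` D)"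
      using alternating_on_Un alternating_on_image D(3) that by blast
    moreover have "card D \<le> card (D \<union> \<pi> ` D)" using finD by (intro card_mono) auto
    ultimately have "D \<union> \<pi> ` D = D" using D sub by (intro max) auto
    then show ?thesis using card finD by (metis card_subset_eq sup.orderI sup_commute)
  qed
  let ?Y = "{Y. Y \<subseteq> V \<and> card Y = card D}"
  have "\<exists>\<pi>. \<pi> permutes V \<and> \<pi> ` D = Y" if Y: "Y \<subseteq> V" "card Y = card D" for Y
  proof -
    have "card (V - D) = card (V - Y)"
      using Y D(1) finite_V by (simp add: card_Diff_subset finite_subset)
    then obtain h where h: "bij_betw h (V - D) (V - Y)"
      using finite_V by (metis finite_Diff finite_same_card_bij)
    obtain g where g: "bij_betw g D Y"
      using Y finite_V finD by (metis finite_same_card_bij finite_subset)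
    define \<pi> where "\<pi> x = (if x \<in> D then g x else if x \<in> V then h x else x)" for x
    have b1: "bij_betw \<pi> D Y"
      using g by (subst bij_betw_cong[of D \<pi> g]) (auto simp: \<pi>_def)
    have b2: "bij_betw \<pi> (V - D) (V - Y)"
      using h by (subst bij_betw_cong[of "V - D" \<pi> h]) (auto simp: \<pi>_def)
    have "bij_betw \<pi> (D \<union> (V - D)) (Y \<union> (V - Y))"
      by (rule bij_betw_combine[OF b1 b2]) auto
    then have "bij_betw \<pi> V V" using D(1) Y(1) by (simp add: Un_absorb1)
    then have "\<pi> permutes V" using D(1) by (intro bij_imp_permutes) (auto simp: \<pi>_def)
    then show ?thesis using b1 by (auto simp: bij_betw_def)
  qed
  then obtain \<pi> where \<pi>: "\<And>Y. Y \<in> ?Y \<Longrightarrow> \<pi> Y permutes V \<and> \<pi> Y ` D = Y"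
    by (metis (mono_tags, lifting) mem_Collect_eq)
  have "inj_on (coset \<circ> \<pi>) ?Y"
  proof (rule inj_onI)
    fix Y Y' assume Y: "Y \<in> ?Y" "Y' \<in> ?Y" "(coset \<circ> \<pi>) Y = (coset \<circ> \<pi>) Y'"
    then have "inv_into UNIV (\<pi> Y) \<circ> \<pi> Y' \<in> U" using \<pi> coset_eq by simp
    then have "(inv_into UNIV (\<pi> Y) \<circ> \<pi> Y') ` D = D" by (rule stable)
    then have "inv_into UNIV (\<pi> Y) ` Y' = D" using \<pi>[OF Y(2)] by (simp only: image_comp[symmetric])
    then have "\<pi> Y ` D = Y'"
      using permutes_bij \<pi>[OF Y(1)] by (metis bij_is_surj image_f_inv_f)
    then show "Y = Y'" using \<pi>[OF Y(1)] by simp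
  qed
  moreover have "(coset \<circ> \<pi>) ` ?Y \<subseteq> {..<f}" using \<pi> coset_less by auto
  ultimately have "card ?Y \<le> f" using card_inj_on_le[of _ ?Y "{..<f}"] by auto
  then have "n choose card D \<le> f" using n_subsets[OF finite_V] by (simp add: n_def)
  moreover have cD: "card D \<le> n" using D(1) finite_V by (simp add: card_mono n_def)
  ultimately have le: "n choose (n - card D) \<le> f"
    using binomial_symmetric[OF cD] by linarith
  \<comment> \<open>The complement of \<open>D\<close> has at most \<open>6 * r\<close> points,
    fewer than half of \<open>n\<close>. In that range binomial coefficients increase, so more than
    \<open>k\<close> missing points would give at least \<open>n choose Suc k\<close>
    images.\<close>
  have "n - card D \<le> k"
  proof (rule ccontr)
    assume "\<not> n - card D \<le> k"
    moreover have "2 * (n - card D) \<le> n" using D(2) large n_def by linarith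
    ultimately have "n choose Suc k \<le> n choose (n - card D)" by (intro binomial_mono) auto
    then show False using few[folded n_def] le by linarith
  qed
  then have "card (V - D) \<le> k" using D(1) finD by (simp add: card_Diff_subset n_def)
  then show ?thesis using that D by blast
qed

end

subsection \<open>Counting perfect matchings\<close>

definition perfect_matching :: "'a set \<Rightarrow> 'a set set \<Rightarrow> bool" where
  "perfect_matching Z N \<longleftrightarrow> (\<forall>e\<in>N. card e = 2) \<and> pairwise disjnt N \<and> \<Union>N = Z"

definition edge_type :: "'a set \<Rightarrow> 'a set set \<Rightarrow> nat \<Rightarrow> nat" where
  "edge_type A N j = card {e \<in> N. card (e \<inter> A) = j}"

definition matchings_of_type :: "'a set \<Rightarrow> 'a set \<Rightarrow> (nat \<Rightarrow> nat) \<Rightarrow> 'a set set set" where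
  "matchings_of_type Z A t = {N. perfect_matching Z N \<and> edge_type A N = t}"

lemma finite_perfect_matching: "finite Z \<Longrightarrow> perfect_matching Z N \<Longrightarrow> finite N"
  by (auto simp: perfect_matching_def intro: finite_UnionD)

lemma finite_perfect_matchings: "finite Z \<Longrightarrow> finite {N. perfect_matching Z N}"
  by (rule finite_subset[of _ "Pow (Pow Z)"]) (auto simp: perfect_matching_def)

lemma finite_matchings_of_type: "finite Z \<Longrightarrow> finite (matchings_of_type Z A t)"
  unfolding matchings_of_type_def by (rule finite_subset[OF _ finite_perfect_matchings]) auto

lemma edge_type_empty [simp]: "edge_type A {} = (\<lambda>j. 0)"
  by (simp add: edge_type_def fun_eq_iff)

lemma edge_type_Un:
  assumes "finite N" "finite N'" "N \<inter> N' = {}"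
  shows "edge_type A (N \<union> N') j = edge_type A N j + edge_type A N' j"
proof -
  have "{e \<in> N \<union> N'. card (e \<inter> A) = j} = {e \<in> N. card (e \<inter> A) = j} \<union> {e \<in> N'. card (e \<inter> A) = j}"
    by auto
  then show ?thesis unfolding edge_type_def using assms by (simp add: card_Un_disjoint disjoint_iff)
qed

lemma edge_type_insert:
  assumes "finite N" "e \<notin> N"
  shows "edge_type A (insert e N) j = edge_type A N j + (if card (e \<inter> A) = j then 1 else 0)"
  using edge_type_Un[of N "{e}" A j] assms by (auto simp: edge_type_def Collect_conv_if)

lemma edge_type_mono: "finite N \<Longrightarrow> C \<subseteq> N \<Longrightarrow> edge_type A C j \<le> edge_type A N j"
  unfolding edge_type_def by (rule card_mono) auto

lemma edge_type_eq_0: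
  assumes "\<And>e. e \<in> N \<Longrightarrow> card e = 2" "j > 2" shows "edge_type A N j = 0"
proof -
  have "card (e \<inter> A) \<le> 2" if "e \<in> N" for e
    using assms(1)[OF that] card_mono[of e "e \<inter> A"] by (metis Int_lower1 card.infinite zero_neq_numeral)
  then have "{e \<in> N. card (e \<inter> A) = j} = {}" using assms(2) by fastforce
  then show ?thesis by (simp only: edge_type_def card.empty)
qed

lemma edge_type_sums:
  assumes "finite N" "\<And>e. e \<in> N \<Longrightarrow> card e = 2" "pairwise disjnt N"
  shows "card (\<Union>N \<inter> A) = edge_type A N 1 + 2 * edge_type A N 2"
    and "card (\<Union>N - A) = edge_type A N 1 + 2 * edge_type A N 0"
    and "card N = edge_type A N 0 + edge_type A N 1 + edge_type A N 2"
proof -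
  have "card (\<Union>N \<inter> A) = edge_type A N 1 + 2 * edge_type A N 2 \<and>
    card (\<Union>N - A) = edge_type A N 1 + 2 * edge_type A N 0 \<and>
    card N = edge_type A N 0 + edge_type A N 1 + edge_type A N 2"
    using assms
  proof (induction N rule: finite_induct)
    case empty then show ?case by simp
  next
    case (insert e N)
    have e: "card e = 2" using insert.prems by simp
    then have fe: "finite e" by (metis card.infinite zero_neq_numeral)
    have fN: "finite (\<Union>N)" using insert.hyps insert.prems(1)
      by (metis card.infinite finite_Union insert_iff zero_neq_numeral)
    have dj: "e \<inter> \<Union>N = {}"
      using insert.prems(2) insert.hyps(2) by (auto simp: pairwise_insert disjnt_def)
    have "\<Union>(insert e N) \<inter> A = (e \<inter> A) \<union> (\<Union>N \<inter> A)" "\<Union>(insert e N) - A = (e - A) \<union> (\<Union>N - A)"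
      by auto
    then have c: "card (\<Union>(insert e N) \<inter> A) = card (e \<inter> A) + card (\<Union>N \<inter> A)"
        "card (\<Union>(insert e N) - A) = card (e - A) + card (\<Union>N - A)"
      using dj fe fN by (auto intro!: card_Un_disjoint simp: disjoint_iff)
    have s: "card (e \<inter> A) + card (e - A) = 2"
      using card_Int_Diff[OF fe, of A] e by simp
    have IH: "card (\<Union>N \<inter> A) = edge_type A N 1 + 2 * edge_type A N 2 \<and>
      card (\<Union>N - A) = edge_type A N 1 + 2 * edge_type A N 0 \<and>
      card N = edge_type A N 0 + edge_type A N 1 + edge_type A N 2"
      using insert by (simp add: pairwise_insert)
    consider "card (e \<inter> A) = 0" "card (e - A) = 2" | "card (e \<inter> A) = 1" "card (e - A) = 1"
      | "card (e \<inter> A) = 2" "card (e - A) = 0" using s by linarith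
    then show ?case
      by cases (use insert.hyps IH c in \<open>simp_all add: edge_type_insert\<close>)
  qed
  then show "card (\<Union>N \<inter> A) = edge_type A N 1 + 2 * edge_type A N 2"
    and "card (\<Union>N - A) = edge_type A N 1 + 2 * edge_type A N 0"
    and "card N = edge_type A N 0 + edge_type A N 1 + edge_type A N 2" by auto
qed

lemma perfect_matching_Diff:
  assumes "perfect_matching Z N" "C \<subseteq> N"
  shows "perfect_matching (Z - \<Union>C) (N - C)"
proof -
  have "e \<inter> c = {}" if "e \<in> N - C" "c \<in> C" for e c
  proof -
    have "e \<in> N" "c \<in> N" "e \<noteq> c" using that assms(2) by auto
    then show ?thesis using assms(1) unfolding perfect_matching_def pairwise_def disjnt_def by simp
  qed
  then have "\<Union>(N - C) \<inter> \<Union>C = {}" by blast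
  moreover have "\<Union>(N - C) \<union> \<Union>C = Z" using assms by (auto simp: perfect_matching_def)
  ultimately have "\<Union>(N - C) = Z - \<Union>C" by blast
  then show ?thesis using assms(1) by (auto simp: perfect_matching_def pairwise_def)
qed

text \<open>Deleting \<open>C\<close> is a bijection onto the perfect matchings of the remaining
  nodes, and the types subtract. The case distinction guards the truncated subtraction: if
  \<open>C\<close> has too many edges of some kind, no matching of the type contains it.\<close>

lemma card_matchings_containing:
  assumes Z: "finite Z" and C: "\<And>e. e \<in> C \<Longrightarrow> card e = 2" "pairwise disjnt C" "\<Union>C \<subseteq> Z"
  shows "card {N \<in> matchings_of_type Z A t. C \<subseteq> N} =
    (if \<forall>j. edge_type A C j \<le> t j
     then card (matchings_of_type (Z - \<Union>C) (A - \<Union>C) (\<lambda>j. t j - edge_type A C j)) else 0)"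
proof (cases "\<forall>j. edge_type A C j \<le> t j")
  case False
  then have "{N \<in> matchings_of_type Z A t. C \<subseteq> N} = {}"
    using edge_type_mono[OF finite_perfect_matching[OF Z]] unfolding matchings_of_type_def by blast
  then show ?thesis using False by (simp only: if_False card.empty)
next
  case True
  have finC: "finite C" using C(3) Z by (meson finite_UnionD finite_subset)
  have type_off: "edge_type (A - \<Union>C) N = edge_type A N" if "\<Union>N \<inter> \<Union>C = {}" for N
  proof -
    have "e \<inter> (A - \<Union>C) = e \<inter> A" if "e \<in> N" for e using that \<open>\<Union>N \<inter> \<Union>C = {}\<close> by blast
    then show ?thesis by (auto simp: edge_type_def fun_eq_iff intro!: arg_cong[of _ _ card])
  qed
  have "bij_betw (\<lambda>N. N - C) {N \<in> matchings_of_type Z A t. C \<subseteq> N}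
    (matchings_of_type (Z - \<Union>C) (A - \<Union>C) (\<lambda>j. t j - edge_type A C j))"
  proof (rule bij_betw_byWitness[where f' = "\<lambda>N. N \<union> C"])
    show "\<forall>N\<in>{N \<in> matchings_of_type Z A t. C \<subseteq> N}. N - C \<union> C = N" by auto
    have disj: "N \<inter> C = {}" if "N \<in> matchings_of_type (Z - \<Union>C) (A - \<Union>C) t'" for N t'
    proof -
      have "\<Union>N \<inter> \<Union>C = {}" using that by (auto simp: matchings_of_type_def perfect_matching_def)
      then have "e = {}" if "e \<in> N" "e \<in> C" for e using that by blast
      then show ?thesis by (metis C(1) card.empty disjoint_iff zero_neq_numeral)
    qed
    then show "\<forall>N\<in>matchings_of_type (Z - \<Union>C) (A - \<Union>C) (\<lambda>j. t j - edge_type A C j). N \<union> C - C = N"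
      by blast
    show "(\<lambda>N. N - C) ` {N \<in> matchings_of_type Z A t. C \<subseteq> N}
      \<subseteq> matchings_of_type (Z - \<Union>C) (A - \<Union>C) (\<lambda>j. t j - edge_type A C j)"
    proof clarify
      fix N assume N: "N \<in> matchings_of_type Z A t" "C \<subseteq> N"
      then have p: "perfect_matching Z N" and t: "edge_type A N = t" by (auto simp: matchings_of_type_def)
      have "perfect_matching (Z - \<Union>C) (N - C)" by (rule perfect_matching_Diff[OF p N(2)])
      then have un: "\<Union>(N - C) = Z - \<Union>C" by (simp add: perfect_matching_def)
      note \<open>perfect_matching (Z - \<Union>C) (N - C)\<close>
      moreover have "edge_type (A - \<Union>C) (N - C) = (\<lambda>j. t j - edge_type A C j)"
      proof -
        have "edge_type A N j = edge_type A (N - C) j + edge_type A C j" for j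
          using edge_type_Un[of "N - C" C A j] finite_perfect_matching[OF Z p] N(2) finC
          by (metis Diff_disjoint Int_commute Un_Diff_cancel2 Un_absorb2 finite_Diff)
        then show ?thesis using type_off[of "N - C"] un t by auto
      qed
      ultimately show "N - C \<in> matchings_of_type (Z - \<Union>C) (A - \<Union>C) (\<lambda>j. t j - edge_type A C j)"
        by (simp add: matchings_of_type_def)
    qed
    show "(\<lambda>N. N \<union> C) ` matchings_of_type (Z - \<Union>C) (A - \<Union>C) (\<lambda>j. t j - edge_type A C j)
      \<subseteq> {N \<in> matchings_of_type Z A t. C \<subseteq> N}"
    proof clarify
      fix N assume N: "N \<in> matchings_of_type (Z - \<Union>C) (A - \<Union>C) (\<lambda>j. t j - edge_type A C j)"
      then have p: "perfect_matching (Z - \<Union>C) N"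
        and t: "edge_type (A - \<Union>C) N = (\<lambda>j. t j - edge_type A C j)"
        by (auto simp: matchings_of_type_def)
      have un: "\<Union>N = Z - \<Union>C" using p by (simp add: perfect_matching_def)
      have "pairwise disjnt (N \<union> C)"
      proof -
        have "e \<inter> c = {}" "c \<inter> e = {}" if "e \<in> N" "c \<in> C" for e c using that un by blast+
        then show ?thesis
          using p C(2) unfolding perfect_matching_def pairwise_def disjnt_def by (simp add: ball_Un)
      qed
      then have "perfect_matching Z (N \<union> C)"
        using p C un by (auto simp: perfect_matching_def)
      moreover have "edge_type A (N \<union> C) = t"
      proof
        fix j
        have "edge_type A (N \<union> C) j = edge_type A N j + edge_type A C j"
          using edge_type_Un[of N C A j] finite_perfect_matching[OF _ p] Z finC disj[OF N] by simp
        also have "edge_type A N = edge_type (A - \<Union>C) N" by (subst type_off) (auto simp: un)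
        finally show "edge_type A (N \<union> C) j = t j" using t True by simp
      qed
      ultimately show "N \<union> C \<in> matchings_of_type Z A t \<and> C \<subseteq> N \<union> C"
        by (simp add: matchings_of_type_def)
    qed
  qed
  then show ?thesis using True by (simp add: bij_betw_same_card)
qed

text \<open>Both sides count the pairs of a matching of type \<open>t\<close> and one of its edges
  with \<open>j\<close> ends in \<open>A\<close>. The form \<open>{e} \<subseteq> N\<close> fits
  \<open>card_matchings_containing\<close>.\<close>

lemma double_count_edges:
  assumes "finite Z"
  shows "t j * card (matchings_of_type Z A t) =
    (\<Sum>e | e \<subseteq> Z \<and> card e = 2 \<and> card (e \<inter> A) = j. card {N \<in> matchings_of_type Z A t. {e} \<subseteq> N})"
proof -
  define E where "E = {e. e \<subseteq> Z \<and> card e = 2 \<and> card (e \<inter> A) = j}"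
  define M where "M = matchings_of_type Z A t"
  have "E \<subseteq> Pow Z" by (auto simp: E_def)
  then have finE: "finite E" using assms finite_subset by blast
  have finM: "finite M" unfolding M_def by (rule finite_matchings_of_type[OF assms])
  have count: "t j = card {e \<in> E. e \<in> N}" if "N \<in> M" for N
  proof -
    have "{e \<in> N. card (e \<inter> A) = j} = {e \<in> E. e \<in> N}"
      using that by (auto simp: M_def E_def matchings_of_type_def perfect_matching_def)
    moreover have "t j = edge_type A N j" using that by (auto simp: M_def matchings_of_type_def)
    ultimately show ?thesis by (simp only: edge_type_def)
  qed
  have "t j * card M = (\<Sum>N\<in>M. t j)" by simp
  also have "\<dots> = (\<Sum>N\<in>M. \<Sum>e\<in>E. if e \<in> N then 1 else 0)"
    using count finE by (intro sum.cong[OF refl]) (simp add: sum.If_cases Int_def)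
  also have "\<dots> = (\<Sum>e\<in>E. \<Sum>N\<in>M. if e \<in> N then 1 else 0)" by (rule sum.swap)
  also have "\<dots> = (\<Sum>e\<in>E. card {N \<in> M. {e} \<subseteq> N})"
    using finM by (intro sum.cong[OF refl]) (simp add: sum.If_cases Int_def)
  finally show ?thesis by (simp only: M_def E_def)
qed

lemma card_edges_of_type:
  assumes "finite Z" "A \<subseteq> Z" and that: "j \<le> 2"
  shows "card {e. e \<subseteq> Z \<and> card e = 2 \<and> card (e \<inter> A) = j} = (card A choose j) * (card (Z - A) choose (2 - j))"
proof -
  let ?L = "{S. S \<subseteq> A \<and> card S = j}" and ?R = "{S. S \<subseteq> Z - A \<and> card S = 2 - j}"
  have fin: "finite A" "finite (Z - A)" using assms finite_subset by auto
  have "bij_betw (\<lambda>(S, T). S \<union> T) (?L \<times> ?R) {e. e \<subseteq> Z \<and> card e = 2 \<and> card (e \<inter> A) = j}"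
  proof (rule bij_betw_byWitness[where f' = "\<lambda>e. (e \<inter> A, e - A)"])
    show "\<forall>p\<in>?L \<times> ?R. ((case p of (S, T) \<Rightarrow> S \<union> T) \<inter> A, (case p of (S, T) \<Rightarrow> S \<union> T) - A) = p" by auto
    show "\<forall>e\<in>{e. e \<subseteq> Z \<and> card e = 2 \<and> card (e \<inter> A) = j}. (case (e \<inter> A, e - A) of (S, T) \<Rightarrow> S \<union> T) = e"
      by auto
    show "(\<lambda>(S, T). S \<union> T) ` (?L \<times> ?R) \<subseteq> {e. e \<subseteq> Z \<and> card e = 2 \<and> card (e \<inter> A) = j}"
    proof clarify
      fix S T assume S: "S \<subseteq> A" "j = card S" and T: "T \<subseteq> Z - A" "card T = 2 - card S"
      have "card (S \<union> T) = card S + card T"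
        using S T fin by (intro card_Un_disjoint) (auto intro: finite_subset)
      moreover have "(S \<union> T) \<inter> A = S" using S T by auto
      ultimately show "S \<union> T \<subseteq> Z \<and> card (S \<union> T) = 2 \<and> card ((S \<union> T) \<inter> A) = card S"
        using S T assms(2) that by auto
    qed
    show "(\<lambda>e. (e \<inter> A, e - A)) ` {e. e \<subseteq> Z \<and> card e = 2 \<and> card (e \<inter> A) = j} \<subseteq> ?L \<times> ?R"
    proof (rule image_subsetI)
      fix e assume "e \<in> {e. e \<subseteq> Z \<and> card e = 2 \<and> card (e \<inter> A) = j}"
      then have e: "e \<subseteq> Z" "card e = 2" "card (e \<inter> A) = j" by auto
      have "card (e \<inter> A) + card (e - A) = 2"
        using card_Int_Diff[of e A] e assms(1) by (metis finite_subset)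
      then show "(e \<inter> A, e - A) \<in> ?L \<times> ?R"
        using e by auto
    qed
  qed
  then have "card {e. e \<subseteq> Z \<and> card e = 2 \<and> card (e \<inter> A) = j} = card (?L \<times> ?R)"
    by (rule bij_betw_same_card[symmetric])
  then show ?thesis using n_subsets[OF fin(1)] n_subsets[OF fin(2)] by (simp only: card_cartesian_product)
qed

text \<open>The division-free form of \<open>|A|! |Z - A|! / (t0! t1! t2! 2^(t0 + t2))\<close>. The
  induction deletes one edge of an occurring kind \<open>j\<close>: double counting relates the
  number for \<open>t\<close> to that for \<open>t'\<close>, and the binomials that count the
  possible edges restore the factorials of the two sides.\<close>

lemma card_matchings_of_type:
  assumes "finite Z" "A \<subseteq> Z" "card A = t 1 + 2 * t 2" "card (Z - A) = t 1 + 2 * t 0" "\<And>j. j > 2 \<Longrightarrow> t j = 0"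
  shows "card (matchings_of_type Z A t) * (fact (t 0) * fact (t 1) * fact (t 2) * 2 ^ (t 0 + t 2)) =
    fact (card A) * fact (card (Z - A))"
  using assms
proof (induction "t 0 + t 1 + t 2" arbitrary: Z A t)
  case 0
  have t: "t = (\<lambda>j. 0)"
  proof
    fix i :: nat
    have "t 0 = 0" "t 1 = 0" "t 2 = 0" using 0 by auto
    moreover have "i = 0 \<or> i = 1 \<or> i = 2 \<or> i > 2" by linarith
    ultimately show "t i = 0" using "0.prems"(5)[of i] by auto
  qed
  have "finite A" using 0 finite_subset by blast
  then have "A = {}" using 0 t by simp
  then have "Z = {}" using 0 t by simp
  have "N = {}" if "perfect_matching Z N" for N
    using that \<open>Z = {}\<close> by (fastforce simp: perfect_matching_def)
  then have "matchings_of_type Z A t = {{}}"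
    using t \<open>Z = {}\<close> by (auto simp: matchings_of_type_def perfect_matching_def)
  then show ?case using t \<open>A = {}\<close> \<open>Z = {}\<close> by simp
next
  case (Suc s)
  have "\<exists>j\<le>2. t j > 0"
  proof (rule ccontr)
    assume "\<not> (\<exists>j\<le>2. t j > 0)"
    then have "t 0 = 0" "t 1 = 0" "t 2 = 0" by auto
    then show False using Suc.hyps(2) by simp
  qed
  then obtain j where j: "j \<le> 2" "t j > 0" by blast
  define t' where "t' = t(j := t j - 1)"
  let ?E = "{e. e \<subseteq> Z \<and> card e = 2 \<and> card (e \<inter> A) = j}"
  let ?F = "\<lambda>t. fact (t 0) * fact (t 1) * fact (t 2) * 2 ^ (t 0 + t 2) :: nat"
  have finA: "finite A" using Suc.prems finite_subset by blast
  have each: "card {N \<in> matchings_of_type Z A t. {e} \<subseteq> N} * ?F t' =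
      fact (card A - j) * fact (card (Z - A) - (2 - j))" if "e \<in> ?E" for e
  proof -
    have e: "e \<subseteq> Z" "card e = 2" "card (e \<inter> A) = j" using that by auto
    have fe: "finite e" using e(2) by (metis card.infinite zero_neq_numeral)
    have ty: "edge_type A {e} i = (if i = j then 1 else 0)" for i
      using edge_type_insert[of "{}" e A i] e by auto
    have t'_eq: "(\<lambda>i. t i - edge_type A {e} i) = t'" by (auto simp: t'_def ty)
    have "card {N \<in> matchings_of_type Z A t. {e} \<subseteq> N} = card (matchings_of_type (Z - e) (A - e) t')"
      using card_matchings_containing[OF Suc.prems(1), of "{e}" A t] e j ty t'_eq by auto
    moreover have cA: "card (A - e) = card A - j"
      using card_Diff_subset_Int[of A e] fe e by (simp add: Int_commute)
    moreover have cB: "card (Z - e - (A - e)) = card (Z - A) - (2 - j)"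
    proof -
      have "Z - e - (A - e) = (Z - A) - (e - A)" by auto
      moreover have "card (e - A) = 2 - j" using card_Int_Diff[OF fe, of A] e by simp
      ultimately show ?thesis using e(1) fe by (simp add: card_Diff_subset Diff_mono)
    qed
    moreover have "card (matchings_of_type (Z - e) (A - e) t') * ?F t' =
      fact (card (A - e)) * fact (card (Z - e - (A - e)))"
    proof (rule Suc.hyps(1))
      have "j = 0 \<or> j = 1 \<or> j = 2" using j by linarith
      then show "s = t' 0 + t' 1 + t' 2"
        using j Suc.hyps(2) by (auto simp: t'_def)
      show "finite (Z - e)" "A - e \<subseteq> Z - e" using Suc.prems by auto
      have "j = 0 \<or> j = 1 \<or> j = 2" using j by linarith
      then show "card (A - e) = t' 1 + 2 * t' 2" "card (Z - e - (A - e)) = t' 1 + 2 * t' 0"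
        unfolding cA cB using Suc.prems j by (auto simp: t'_def)
      show "t' i = 0" if "i > 2" for i using that Suc.prems j by (auto simp: t'_def)
    qed
    ultimately show ?thesis by simp
  qed
  have "t j * card (matchings_of_type Z A t) * ?F t' =
      card ?E * (fact (card A - j) * fact (card (Z - A) - (2 - j)))"
  proof -
    have "t j * card (matchings_of_type Z A t) * ?F t' =
        (\<Sum>e\<in>?E. card {N \<in> matchings_of_type Z A t. {e} \<subseteq> N} * ?F t')"
      by (simp only: double_count_edges[OF Suc.prems(1)] sum_distrib_right)
    also have "\<dots> = (\<Sum>e\<in>?E. fact (card A - j) * fact (card (Z - A) - (2 - j)))"
      by (rule sum.cong[OF refl each])
    finally show ?thesis by simp
  qed
  also have "\<dots> = ((card A choose j) * fact (card A - j)) * ((card (Z - A) choose (2 - j)) * fact (card (Z - A) - (2 - j)))"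
    using card_edges_of_type[OF Suc.prems(1,2) j(1)] by simp
  finally have eq: "t j * card (matchings_of_type Z A t) * ?F t' =
    ((card A choose j) * fact (card A - j)) * ((card (Z - A) choose (2 - j)) * fact (card (Z - A) - (2 - j)))" .
  have "fact j * fact (2 - j) * (t j * card (matchings_of_type Z A t) * ?F t') =
    (fact j * fact (card A - j) * (card A choose j)) *
    (fact (2 - j) * fact (card (Z - A) - (2 - j)) * (card (Z - A) choose (2 - j)))"
    unfolding eq by (simp add: ac_simps)
  also have "\<dots> = fact (card A) * fact (card (Z - A))"
  proof -
    have "j = 0 \<or> j = 1 \<or> j = 2" using j by linarith
    then have "j \<le> card A" "2 - j \<le> card (Z - A)" using Suc.prems j by auto
    then show ?thesis by (simp only: binomial_fact_lemma)
  qed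
  finally have eq: "fact j * fact (2 - j) * (t j * card (matchings_of_type Z A t) * ?F t') =
    fact (card A) * fact (card (Z - A))" .
  \<comment> \<open>The factor \<open>fact j * fact (2 - j)\<close> is 2 for an edge inside one side
    and 1 for a crossing edge, which is the power of two that \<open>?F\<close> loses with the
    edge.\<close>
  have "fact j * fact (2 - j) * t j * ?F t' = ?F t"
  proof -
    obtain u where u: "t j = Suc u" using j by (cases "t j") auto
    have "j = 0 \<or> j = 1 \<or> j = 2" using j by linarith
    then show ?thesis by (elim disjE) (use u in \<open>simp_all add: t'_def algebra_simps\<close>)
  qed
  moreover have "fact j * fact (2 - j) * (t j * m * ?F t') = (fact j * fact (2 - j) * t j * ?F t') * m" for m
    by (simp only: ac_simps)
  ultimately have "?F t * card (matchings_of_type Z A t) = fact (card A) * fact (card (Z - A))"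
    using eq by (simp only:)
  then show ?case by (simp only: mult.commute)
qed

section \<open>Shares of matchings as polynomials, and their extrapolation\<close>

text \<open>Exhibits the quotient of two factorials as a falling factorial, hence as a polynomial in
  \<open>x\<close> of degree \<open>b\<close>.\<close>

lemma fact_eq_prod:
  assumes "b \<le> x"
  shows "(fact x :: real) = fact (x - b) * (\<Prod>j<b. real x - real j)"
  using assms
proof (induction b)
  case 0 then show ?case by simp
next
  case (Suc b)
  have "(fact (x - b) :: real) = (real x - real b) * fact (x - Suc b)"
    using Suc.prems by (simp add: Suc_diff_Suc[symmetric] of_nat_diff)
  moreover have "(fact x :: real) = fact (x - b) * (\<Prod>j<b. real x - real j)"
    using Suc by simp
  ultimately show ?case by (simp only: prod.lessThan_Suc ac_simps)
qed

text \<open>The weight \<open>\<mu> x\<close> is the value at \<open>z\<close> of the Lagrange basis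
  polynomial for the point \<open>x\<close>. The weights do not depend on \<open>p\<close>, so that
  one choice serves all share polynomials at once.\<close>

lemma polynomial_extrapolation:
  fixes z :: real
  obtains \<mu> :: "nat \<Rightarrow> real" where
    "\<And>p. degree p \<le> k \<Longrightarrow> (\<Sum>x\<le>k. \<mu> x * poly p (real x)) = poly p z"
proof -
  define L :: "nat \<Rightarrow> real poly" where
    "L x = (\<Prod>j\<in>{..k} - {x}. Polynomial.smult (1 / (real x - real j)) [:- real j, 1:])" for x
  have polyL: "poly (L x) y = (\<Prod>j\<in>{..k} - {x}. (y - real j) / (real x - real j))" for x y
    unfolding L_def poly_prod by (intro prod.cong refl) (simp add: diff_divide_distrib)
  have L: "poly (L x) (real y) = (if x = y then 1 else 0)" if "y \<le> k" for x y
  proof (cases "x = y")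
    case True
    then show ?thesis unfolding polyL by (simp add: prod.neutral)
  next
    case False
    then have "(\<Prod>j\<in>{..k} - {x}. (real y - real j) / (real x - real j)) = 0"
      using that by (intro prod_zero bexI[of _ y]) auto
    then show ?thesis using False by (simp add: polyL)
  qed
  have degL: "degree (L x) \<le> k" if "x \<le> k" for x
  proof -
    have "degree (L x) \<le> sum (degree \<circ> (\<lambda>j. Polynomial.smult (1 / (real x - real j)) [:- real j, 1:])) ({..k} - {x})"
      unfolding L_def by (rule degree_prod_sum_le) simp
    also have "\<dots> \<le> (\<Sum>j\<in>{..k} - {x}. 1)"
      by (intro sum_mono) (auto intro: order_trans[OF degree_smult_le])
    also have "\<dots> \<le> k" using that by simp
    finally show ?thesis .
  qed
  show ?thesis
  proof (rule that[of "\<lambda>x. poly (L x) z"])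
    fix p :: "real poly" assume p: "degree p \<le> k"
    define q where "q = (\<Sum>x\<le>k. Polynomial.smult (poly p (real x)) (L x))"
    have "degree q \<le> k"
      unfolding q_def using degL by (intro degree_sum_le) (auto intro: order_trans[OF degree_smult_le])
    moreover have "poly q (real y) = poly p (real y)" if "y \<le> k" for y
    proof -
      have "poly q (real y) = (\<Sum>x\<le>k. poly p (real x) * poly (L x) (real y))"
        by (simp add: q_def poly_sum)
      also have "\<dots> = (\<Sum>x\<le>k. if x = y then poly p (real x) else 0)"
        using that by (intro sum.cong) (auto simp: L)
      finally show ?thesis using that by simp
    qed
    moreover have "card (real ` {..k}) = Suc k" by (simp add: card_image)
    ultimately have "p = q"
      using p by (intro poly_eqI_degree[of "real ` {..k}"]) auto
    then have "poly p z = poly q z" by simp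
    then show "(\<Sum>x\<le>k. poly (L x) z * poly p (real x)) = poly p z"
      by (simp add: q_def poly_sum mult.commute)
  qed
qed

locale odd_halves =
  fixes A B :: "'a set" and k :: nat
  assumes fin: "finite A" "finite B" and AB: "A \<inter> B = {}"
    and card_A: "card A = 2 * k + 1" and card_B: "card B = 2 * k + 1"
begin

text \<open>As both sides have the same size, \<open>x\<close> edges inside \<open>A\<close> force
  \<open>x\<close> edges inside \<open>B\<close>; the \<open>2 * k + 1 - 2 * x\<close> nodes left on
  either side are matched across.\<close>

definition type_of :: "nat \<Rightarrow> nat \<Rightarrow> nat" where
  "type_of x j = (if j = 0 \<or> j = 2 then x else if j = 1 then 2 * k + 1 - 2 * x else 0)"

definition level :: "nat \<Rightarrow> 'a set set set" where
  "level x = matchings_of_type (A \<union> B) A (type_of x)"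

text \<open>
  The share of the matchings with \<open>x\<close> edges in \<open>A\<close> that contain \<open>C\<close> is, up to a constant factor, the
  following polynomial in \<open>x\<close>. Its value at \<open>x = k + 1/2\<close>, where no edges between \<open>A\<close> and \<open>B\<close> would
  be left, is nonnegative although no such matching exists.
\<close>
definition share_poly :: "'a set set \<Rightarrow> real poly" where
  "share_poly C = (\<Prod>j<edge_type A C 0. [:- real j, 1:]) * (\<Prod>j<edge_type A C 2. [:- real j, 1:]) *
     (\<Prod>j<edge_type A C 1. [:real (2 * k + 1) - real j, - 2:])"

lemma BA: "A \<union> B - A = B" using AB by auto

lemma poly_share_poly:
  "poly (share_poly C) x = (\<Prod>j<edge_type A C 0. x - real j) * (\<Prod>j<edge_type A C 2. x - real j) *
     (\<Prod>j<edge_type A C 1. real (2 * k + 1) - real j - 2 * x)"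
  by (simp add: share_poly_def poly_prod algebra_simps)

lemma card_level:
  assumes "x \<le> k"
  shows "card (level x) * (fact x * fact (2 * k + 1 - 2 * x) * fact x * 2 ^ (x + x)) =
    fact (2 * k + 1) * fact (2 * k + 1)"
proof -
  have "card (level x) * (fact (type_of x 0) * fact (type_of x 1) * fact (type_of x 2) *
      2 ^ (type_of x 0 + type_of x 2)) = fact (card A) * fact (card (A \<union> B - A))"
    unfolding level_def
    by (rule card_matchings_of_type) (use fin card_A card_B assms in \<open>auto simp: BA type_of_def\<close>)
  then show ?thesis unfolding BA card_A card_B by (simp add: type_of_def)
qed

lemma card_level_pos: "x \<le> k \<Longrightarrow> card (level x) > 0"
  using card_level[of x] by (cases "card (level x)") auto

lemma level_edge_type: "N \<in> level x \<Longrightarrow> edge_type A N = type_of x"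
  by (simp add: level_def matchings_of_type_def)

lemma perfect_matching_level:
  assumes "perfect_matching (A \<union> B) N"
  shows "edge_type A N 2 \<le> k" "N \<in> level (edge_type A N 2)"
proof -
  have fN: "finite N" using finite_perfect_matching[OF _ assms] fin by simp
  have N: "\<And>e. e \<in> N \<Longrightarrow> card e = 2" "pairwise disjnt N" "\<Union>N = A \<union> B"
    using assms by (auto simp: perfect_matching_def)
  have "(A \<union> B) \<inter> A = A" by auto
  then have c: "2 * k + 1 = edge_type A N 1 + 2 * edge_type A N 2"
    "2 * k + 1 = edge_type A N 1 + 2 * edge_type A N 0"
    using edge_type_sums(1,2)[OF fN N(1,2), where A = A] card_A card_B BA N(3) by auto
  then show "edge_type A N 2 \<le> k" by linarith
  have "edge_type A N j = type_of (edge_type A N 2) j" for j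
  proof -
    consider "j = 0" | "j = 1" | "j = 2" | "j > 2" by linarith
    then show ?thesis
      by cases (use c edge_type_eq_0[of N j A] N(1) in \<open>auto simp: type_of_def\<close>)
  qed
  then have "edge_type A N = type_of (edge_type A N 2)" by (rule ext)
  then show "N \<in> level (edge_type A N 2)"
    using assms unfolding level_def matchings_of_type_def by blast
qed

text \<open>The share is a quotient of two instances of \<open>card_matchings_of_type\<close>. The
  factorials that depend on \<open>x\<close> leave the falling factorials of
  \<open>share_poly\<close>, and \<open>K\<close> collects the rest. If \<open>C\<close> does not
  fit into the type of level \<open>x\<close>, no matching there contains it and one of the falling
  factorials has a zero factor.\<close>

lemma share_eq:
  assumes C: "\<And>e. e \<in> C \<Longrightarrow> card e = 2" "pairwise disjnt C" "\<Union>C \<subseteq> A \<union> B"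
  obtains K :: real where "K \<ge> 0"
    "\<And>x. x \<le> k \<Longrightarrow> real (card {N \<in> level x. C \<subseteq> N}) = real (card (level x)) * (K * poly (share_poly C) (real x))"
proof -
  define m where "m = 2 * k + 1"
  define \<alpha> \<beta> \<gamma> where "\<alpha> = edge_type A C 2" and "\<beta> = edge_type A C 0" and "\<gamma> = edge_type A C 1"
  define K :: real where "K = fact (m - \<gamma> - 2 * \<alpha>) * fact (m - \<gamma> - 2 * \<beta>) * 2 ^ (\<alpha> + \<beta>) / (fact m * fact m)"
  have finZ: "finite (A \<union> B)" using fin by simp
  have finC: "finite C" using C(3) finZ by (meson finite_UnionD finite_subset)
  note sums = edge_type_sums(1,2)[OF finC C(1,2), where A = A, folded \<alpha>_def \<beta>_def \<gamma>_def]
  have cA: "card (A - \<Union>C) = m - \<gamma> - 2 * \<alpha>"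
    using card_Diff_subset_Int[of A "\<Union>C"] sums(1) fin card_A by (simp add: Int_commute m_def)
  have cB: "card (A \<union> B - \<Union>C - (A - \<Union>C)) = m - \<gamma> - 2 * \<beta>"
  proof -
    have "A \<union> B - \<Union>C - (A - \<Union>C) = B - \<Union>C" "B \<inter> \<Union>C = \<Union>C - A" using AB C(3) by auto
    then show ?thesis
      using card_Diff_subset_Int[of B "\<Union>C"] sums(2) fin card_B finite_subset[OF C(3) finZ] by (simp add: m_def)
  qed
  have main: "real (card {N \<in> level x. C \<subseteq> N}) = real (card (level x)) * (K * poly (share_poly C) (real x))"
    if x: "x \<le> k" for x
  proof (cases "\<forall>j. edge_type A C j \<le> type_of x j")
    case True
    define g where "g = m - 2 * x"
    have le: "\<alpha> \<le> x" "\<beta> \<le> x" "\<gamma> \<le> g"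
      using True[THEN spec, of 2] True[THEN spec, of 0] True[THEN spec, of 1]
      by (auto simp: \<alpha>_def \<beta>_def \<gamma>_def g_def m_def type_of_def)
    define t' where "t' j = type_of x j - edge_type A C j" for j
    have t': "t' 0 = x - \<beta>" "t' 1 = g - \<gamma>" "t' 2 = x - \<alpha>"
      by (auto simp: t'_def type_of_def \<alpha>_def \<beta>_def \<gamma>_def g_def m_def)
    have "card {N \<in> level x. C \<subseteq> N} = card (matchings_of_type (A \<union> B - \<Union>C) (A - \<Union>C) t')"
      unfolding level_def t'_def using card_matchings_containing[OF finZ C] True by simp
    moreover have "card (matchings_of_type (A \<union> B - \<Union>C) (A - \<Union>C) t') *
        (fact (t' 0) * fact (t' 1) * fact (t' 2) * 2 ^ (t' 0 + t' 2)) =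
        fact (card (A - \<Union>C)) * fact (card (A \<union> B - \<Union>C - (A - \<Union>C)))"
    proof (rule card_matchings_of_type)
      show "finite (A \<union> B - \<Union>C)" "A - \<Union>C \<subseteq> A \<union> B - \<Union>C" using finZ by auto
      show "card (A - \<Union>C) = t' 1 + 2 * t' 2" "card (A \<union> B - \<Union>C - (A - \<Union>C)) = t' 1 + 2 * t' 0"
        unfolding cA cB t' using le x by (auto simp: g_def m_def)
      show "t' j = 0" if "j > 2" for j using that by (simp add: t'_def type_of_def)
    qed
    ultimately have eqC: "card {N \<in> level x. C \<subseteq> N} *
        (fact (x - \<beta>) * fact (g - \<gamma>) * fact (x - \<alpha>) * 2 ^ (x - \<beta> + (x - \<alpha>))) =
        fact (m - \<gamma> - 2 * \<alpha>) * fact (m - \<gamma> - 2 * \<beta>)"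
      by (simp only: t' cA cB)
    define D :: real where "D = fact (x - \<beta>) * fact (g - \<gamma>) * fact (x - \<alpha>) * 2 ^ (x - \<beta> + (x - \<alpha>))"
    define P where "P = poly (share_poly C) (real x)"
    have eqC': "real (card {N \<in> level x. C \<subseteq> N}) * D = fact (m - \<gamma> - 2 * \<alpha>) * fact (m - \<gamma> - 2 * \<beta>)"
      using arg_cong[OF eqC, of real] by (simp add: D_def)
    have "real (card (level x)) * (fact x * fact g * fact x * 2 ^ (x + x)) = fact m * fact m"
      using arg_cong[OF card_level[OF x], of real]
      by (simp only: g_def m_def of_nat_mult of_nat_fact of_nat_power of_nat_numeral)
    also have "fact x * fact g * fact x * 2 ^ (x + x) = D * P * 2 ^ (\<alpha> + \<beta>)"
    proof -
      have "x + x = (x - \<beta> + (x - \<alpha>)) + (\<alpha> + \<beta>)" using le by linarith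
      then have two: "(2::real) ^ (x + x) = 2 ^ (x - \<beta> + (x - \<alpha>)) * 2 ^ (\<alpha> + \<beta>)"
        by (metis power_add)
      have rg: "real (2 * k + 1) - real j - 2 * real x = real g - real j" for j
        using x by (simp add: g_def m_def of_nat_diff)
      have "(fact x :: real) * fact g * fact x =
          (fact (x - \<beta>) * (\<Prod>j<\<beta>. real x - real j)) * (fact (g - \<gamma>) * (\<Prod>j<\<gamma>. real g - real j)) *
          (fact (x - \<alpha>) * (\<Prod>j<\<alpha>. real x - real j))"
        using fact_eq_prod le by metis
      then show ?thesis
        unfolding two D_def P_def poly_share_poly rg \<alpha>_def[symmetric] \<beta>_def[symmetric] \<gamma>_def[symmetric]
        by (simp only: ac_simps)
    qed
    finally have eqL: "real (card (level x)) * (D * P * 2 ^ (\<alpha> + \<beta>)) = fact m * fact m" .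
    have "D \<noteq> 0" by (simp add: D_def)
    have "real (card (level x)) * (K * P) * D =
      (real (card (level x)) * (D * P * 2 ^ (\<alpha> + \<beta>))) *
      (fact (m - \<gamma> - 2 * \<alpha>) * fact (m - \<gamma> - 2 * \<beta>)) / (fact m * fact m)"
      by (simp add: K_def)
    also have "\<dots> = real (card {N \<in> level x. C \<subseteq> N}) * D"
      unfolding eqL eqC' by simp
    finally show ?thesis using \<open>D \<noteq> 0\<close> unfolding P_def by simp
  next
    case False
    then have "card {N \<in> level x. C \<subseteq> N} = 0"
      unfolding level_def using card_matchings_containing[OF finZ C, where A = A and t = "type_of x"] by (simp only: if_False)
    moreover have "poly (share_poly C) (real x) = 0"
    proof -
      from False obtain j where j: "edge_type A C j > type_of x j" by (auto simp: not_le)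
      then have "j = 0 \<or> j = 1 \<or> j = 2" using edge_type_eq_0[of C j A] C(1) by (cases "j > 2") auto
      then consider "edge_type A C 0 > x" | "edge_type A C 1 > m - 2 * x" | "edge_type A C 2 > x"
        using j by (auto simp: type_of_def m_def)
      then show ?thesis
      proof cases
        case 1
        then have "(\<Prod>j<edge_type A C 0. real x - real j) = 0" by (intro prod_zero) auto
        then show ?thesis by (simp add: poly_share_poly)
      next
        case 2
        have "\<exists>j\<in>{..<edge_type A C 1}. real (2 * k + 1) - real j - 2 * real x = 0"
          using 2 x by (intro bexI[of _ "m - 2 * x"]) (auto simp: m_def of_nat_diff)
        then have "(\<Prod>j<edge_type A C 1. real (2 * k + 1) - real j - 2 * real x) = 0"
          by (intro prod_zero) auto
        then show ?thesis by (simp only: poly_share_poly mult_zero_right)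
      next
        case 3
        then have "(\<Prod>j<edge_type A C 2. real x - real j) = 0" by (intro prod_zero) auto
        then show ?thesis by (simp add: poly_share_poly)
      qed
    qed
    ultimately show ?thesis by simp
  qed
  have "K \<ge> 0" by (simp add: K_def)
  then show ?thesis using that main by blast
qed

lemma degree_share_poly:
  assumes "finite C" "\<And>e. e \<in> C \<Longrightarrow> card e = 2" "pairwise disjnt C"
  shows "degree (share_poly C) \<le> card C"
proof -
  have lin: "degree (\<Prod>j<n. [:a j, b j:]) \<le> n" for n and a b :: "nat \<Rightarrow> real"
  proof -
    have "degree (\<Prod>j<n. [:a j, b j:]) \<le> sum (degree \<circ> (\<lambda>j. [:a j, b j:])) {..<n}"
      by (rule degree_prod_sum_le) simp
    also have "\<dots> \<le> (\<Sum>j<n. 1)" by (intro sum_mono) simp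
    finally show ?thesis by simp
  qed
  have "degree (share_poly C) \<le> edge_type A C 0 + edge_type A C 2 + edge_type A C 1"
    unfolding share_poly_def
    by (intro order_trans[OF degree_mult_le] add_mono lin)
  then show ?thesis using edge_type_sums(3)[OF assms, of A] by simp
qed

text \<open>The first two products have only factors \<open>k + 1/2 - j\<close> with
  \<open>j < k\<close>, which are positive. If \<open>C\<close> has a crossing edge, the third
  product begins with \<open>2 * k + 1 - 2 * (k + 1/2) = 0\<close>; otherwise it is empty.\<close>

lemma share_poly_half_nonneg:
  assumes "finite C" "\<And>e. e \<in> C \<Longrightarrow> card e = 2" "pairwise disjnt C" "card C \<le> k"
  shows "poly (share_poly C) (real k + 1/2) \<ge> 0"
proof -
  have "edge_type A C 0 \<le> k" "edge_type A C 2 \<le> k"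
    using edge_type_sums(3)[OF assms(1-3), of A] assms(4) by auto
  moreover have third: "(\<Prod>j<n. real (2 * k + 1) - real j - 2 * (real k + 1/2)) \<ge> 0" for n
  proof (cases n)
    case (Suc n')
    then have "(\<Prod>j<n. real (2 * k + 1) - real j - 2 * (real k + 1/2)) = 0"
      by (intro prod_zero) (auto intro!: bexI[of _ 0])
    then show ?thesis by (rule eq_refl[OF sym])
  qed simp
  ultimately show ?thesis
    unfolding poly_share_poly by (intro mult_nonneg_nonneg third) (auto intro!: prod_nonneg)
qed

text \<open>The weight \<open>\<mu> x\<close> is spread evenly over level \<open>x\<close>, so that
  a weighted sum evaluates a polynomial of level averages at \<open>k + 1/2\<close>. There the
  constant 1 stays 1, the number \<open>2 * k + 1 - 2 * x\<close> of crossing edges vanishes, and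
  the shares are nonnegative. Nonnegative weights could not achieve this, since by parity every
  perfect matching has a crossing edge.\<close>

theorem signed_weights:
  assumes "k > 0"
  shows "\<exists>w :: 'a set set \<Rightarrow> real.
    (\<Sum>N | perfect_matching (A \<union> B) N. w N) = 1 \<and>
    (\<Sum>N | perfect_matching (A \<union> B) N. w N * real (edge_type A N 1)) = 0 \<and>
    (\<forall>C. (\<forall>e\<in>C. card e = 2) \<longrightarrow> pairwise disjnt C \<longrightarrow> \<Union>C \<subseteq> A \<union> B \<longrightarrow> card C \<le> k \<longrightarrow>
      0 \<le> (\<Sum>N | perfect_matching (A \<union> B) N \<and> C \<subseteq> N. w N))"
proof -
  obtain \<mu> where \<mu>: "\<And>p. degree p \<le> k \<Longrightarrow> (\<Sum>x\<le>k. \<mu> x * poly p (real x)) = poly p (real k + 1/2)"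
    using polynomial_extrapolation[of k "real k + 1/2"] by blast
  define w where "w N = \<mu> (edge_type A N 2) / real (card (level (edge_type A N 2)))" for N
  have finP: "finite {N. perfect_matching (A \<union> B) N}" using finite_perfect_matchings[of "A \<union> B"] fin by simp
  have by_level: "(\<Sum>N | perfect_matching (A \<union> B) N. w N * h N) =
      (\<Sum>x\<le>k. \<mu> x / real (card (level x)) * (\<Sum>N\<in>level x. h N))" for h
  proof -
    have "(\<Sum>N | perfect_matching (A \<union> B) N. w N * h N) =
      (\<Sum>x\<le>k. \<Sum>N | N \<in> {N. perfect_matching (A \<union> B) N} \<and> edge_type A N 2 = x. w N * h N)"
      by (rule sum.group[symmetric]) (use finP perfect_matching_level in auto)
    also have "\<dots> = (\<Sum>x\<le>k. \<Sum>N\<in>level x. \<mu> x / real (card (level x)) * h N)"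
    proof (intro sum.cong refl)
      fix x
      have "perfect_matching (A \<union> B) N \<and> edge_type A N 2 = x" if "N \<in> level x" for N
        using that level_edge_type[OF that] by (simp add: level_def matchings_of_type_def type_of_def)
      then show "{N \<in> {N. perfect_matching (A \<union> B) N}. edge_type A N 2 = x} = level x"
        using perfect_matching_level(2) by blast
      fix N assume "N \<in> level x"
      then have "edge_type A N 2 = x" by (simp add: level_edge_type type_of_def)
      then show "w N * h N = \<mu> x / real (card (level x)) * h N" by (simp add: w_def)
    qed
    finally show ?thesis by (simp only: sum_distrib_left)
  qed
  show ?thesis
  proof (intro exI[of _ w] conjI allI impI)
    have "(\<Sum>N | perfect_matching (A \<union> B) N. w N) = (\<Sum>x\<le>k. \<mu> x * poly 1 (real x))"
      using by_level[of "\<lambda>N. 1"] card_level_pos by (simp add: less_imp_neq[OF card_level_pos, symmetric])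
    also have "\<dots> = 1" by (subst \<mu>) auto
    finally show "(\<Sum>N | perfect_matching (A \<union> B) N. w N) = 1" .
    have "(\<Sum>N | perfect_matching (A \<union> B) N. w N * real (edge_type A N 1)) =
      (\<Sum>x\<le>k. \<mu> x / real (card (level x)) * (\<Sum>N\<in>level x. real (2 * k + 1) - 2 * real x))"
      unfolding by_level
      by (intro sum.cong arg_cong2[of _ _ _ _ times] refl)
        (simp add: level_edge_type type_of_def of_nat_diff)
    also have "\<dots> = (\<Sum>x\<le>k. \<mu> x * poly [:real (2 * k + 1), - 2:] (real x))"
      using card_level_pos by (intro sum.cong) (auto simp: less_imp_neq[OF card_level_pos, symmetric])
    \<comment> \<open>Extrapolating a linear polynomial requires \<open>k \<ge> 1\<close>.\<close>
    also have "\<dots> = 0" using assms by (subst \<mu>) auto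
    finally show "(\<Sum>N | perfect_matching (A \<union> B) N. w N * real (edge_type A N 1)) = 0" .
    fix C :: "'a set set"
    assume "\<forall>e\<in>C. card e = 2" and C': "pairwise disjnt C" "\<Union>C \<subseteq> A \<union> B" "card C \<le> k"
    then have C: "\<And>e. e \<in> C \<Longrightarrow> card e = 2" "pairwise disjnt C" "\<Union>C \<subseteq> A \<union> B" "card C \<le> k" by auto
    have finC: "finite C" using C(3) fin by (meson finite_UnI finite_UnionD finite_subset)
    obtain K where K: "K \<ge> 0" "\<And>x. x \<le> k \<Longrightarrow>
        real (card {N \<in> level x. C \<subseteq> N}) = real (card (level x)) * (K * poly (share_poly C) (real x))"
      using share_eq[OF C(1-3)] by blast
    have "(\<Sum>N | perfect_matching (A \<union> B) N \<and> C \<subseteq> N. w N) =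
        (\<Sum>N | perfect_matching (A \<union> B) N. w N * of_bool (C \<subseteq> N))"
      using finP by (simp add: sum.inter_filter[symmetric] of_bool_def if_distrib cong: if_cong)
    also have "\<dots> = (\<Sum>x\<le>k. \<mu> x / real (card (level x)) * real (card {N \<in> level x. C \<subseteq> N}))"
      unfolding by_level
    proof (intro sum.cong arg_cong2[of _ _ _ _ times] refl)
      fix x
      have "finite (level x)" unfolding level_def using fin by (intro finite_matchings_of_type) simp
      then show "(\<Sum>N\<in>level x. of_bool (C \<subseteq> N)) = real (card {N \<in> level x. C \<subseteq> N})"
        by (simp add: sum_of_bool_eq Int_def)
    qed
    also have "\<dots> = (\<Sum>x\<le>k. K * (\<mu> x * poly (share_poly C) (real x)))"
      using card_level_pos by (intro sum.cong) (auto simp: K(2) less_imp_neq[OF card_level_pos, symmetric])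
    also have "\<dots> = K * poly (share_poly C) (real k + 1/2)"
      using degree_share_poly[OF finC C(1,2)] C(4) by (subst sum_distrib_left[symmetric], subst \<mu>) auto
    also have "\<dots> \<ge> 0" using K(1) share_poly_half_nonneg[OF finC C(1,2,4)] by simp
    finally show "0 \<le> (\<Sum>N | perfect_matching (A \<union> B) N \<and> C \<subseteq> N. w N)" .
  qed
qed

end

subsection \<open>Functions of matchings\<close>

abbreviation relabel :: "('a \<Rightarrow> 'a) \<Rightarrow> 'a set set \<Rightarrow> 'a set set" where
  "relabel \<pi> M \<equiv> (`) \<pi> ` M"

lemma relabel_comp: "relabel (\<pi> \<circ> \<sigma>) M = relabel \<pi> (relabel \<sigma> M)"
  by (simp add: image_comp comp_def)

lemma relabel_inv: "bij \<pi> \<Longrightarrow> relabel (inv_into UNIV \<pi>) (relabel \<pi> M) = M"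
  by (simp add: image_comp comp_def bij_is_inj)

lemma pairwise_disjnt_relabel:
  assumes "inj \<pi>" "pairwise disjnt M" shows "pairwise disjnt (relabel \<pi> M)"
  unfolding pairwise_def disjnt_def
proof (intro ballI impI)
  fix x y assume "x \<in> relabel \<pi> M" "y \<in> relabel \<pi> M" "x \<noteq> y"
  then obtain e e' where e: "e \<in> M" "e' \<in> M" "x = \<pi> ` e" "y = \<pi> ` e'" "e \<noteq> e'" by blast
  then have "e \<inter> e' = {}" using assms(2) by (simp add: pairwise_def disjnt_def)
  then show "x \<inter> y = {}" unfolding e using image_Int[OF assms(1), of e e'] by simp
qed

lemma perfect_matching_relabel:
  assumes "\<pi> permutes Z" "perfect_matching Z N"
  shows "perfect_matching Z (relabel \<pi> N)"
proof -
  have inj: "inj \<pi>" using assms(1) by (rule permutes_inj)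
  have "card (\<pi> ` e) = card e" for e using inj by (meson card_image inj_on_subset subset_UNIV)
  moreover have "\<Union> (relabel \<pi> N) = \<pi> ` Z" using assms(2) by (auto simp: perfect_matching_def)
  ultimately show ?thesis
    using assms pairwise_disjnt_relabel[OF inj] by (simp add: perfect_matching_def permutes_image)
qed

text \<open>Choosing a point of \<open>W\<close> in each edge is injective, because the edges are
  disjoint.\<close>

lemma card_edges_meeting_le:
  assumes "pairwise disjnt N" "finite W"
  shows "card {e \<in> N. e \<inter> W \<noteq> {}} \<le> card W"
proof -
  have "\<exists>x. x \<in> e \<inter> W" if "e \<in> {e \<in> N. e \<inter> W \<noteq> {}}" for e using that by blast
  then obtain p where p: "\<And>e. e \<in> {e \<in> N. e \<inter> W \<noteq> {}} \<Longrightarrow> p e \<in> e \<inter> W" by metis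
  have "inj_on p {e \<in> N. e \<inter> W \<noteq> {}}"
  proof (rule inj_onI, rule ccontr)
    fix e e' assume e: "e \<in> {e \<in> N. e \<inter> W \<noteq> {}}" "e' \<in> {e \<in> N. e \<inter> W \<noteq> {}}" "p e = p e'" "e \<noteq> e'"
    then have "e \<inter> e' = {}" using assms(1) by (simp add: pairwise_def disjnt_def)
    then show False using p[OF e(1)] p[OF e(2)] e(3) by auto
  qed
  then show ?thesis using p by (intro card_inj_on_le[OF _ _ assms(2)]) auto
qed

lemma transpose_fixes: "u \<notin> e \<Longrightarrow> v \<notin> e \<Longrightarrow> Transposition.transpose u v ` e = e"
  by (force simp: Transposition.transpose_def image_iff)

lemma invariant_on_perfect_matchings:
  assumes "finite Z" "perfect_matching Z N" "perfect_matching Z N'"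
    and inv: "\<And>M a b. M \<in> \<M> \<Longrightarrow> a \<in> Z \<Longrightarrow> b \<in> Z \<Longrightarrow>
      relabel (Transposition.transpose a b) M \<in> \<M> \<and> g (relabel (Transposition.transpose a b) M) = g M"
    and "F \<union> N \<in> \<M>" "\<Union>F \<inter> Z = {}"
  shows "g (F \<union> N) = g (F \<union> N')"
  using assms
proof (induction "card Z" arbitrary: Z N N' F rule: less_induct)
  case less
  show ?case
  proof (cases "Z = {}")
    case True
    have "N = {}" if "perfect_matching {} N" for N :: "'a set set"
      using that by (fastforce simp: perfect_matching_def)
    then show ?thesis using less.prems True by metis
  next
    case False
    then obtain v where v: "v \<in> Z" by blast
    have partner: "\<exists>u. u \<noteq> v \<and> {v, u} \<in> N" if N: "perfect_matching Z N" for N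
    proof -
      obtain e where e: "e \<in> N" "v \<in> e" using N v by (auto simp: perfect_matching_def)
      then have "card e = 2" using N by (simp add: perfect_matching_def)
      then obtain u where "e = {v, u}" "u \<noteq> v" using e(2) by (auto simp: card_2_iff)
      then show ?thesis using e by blast
    qed
    obtain u where u: "u \<noteq> v" "{v, u} \<in> N" using partner less.prems(2) by blast
    obtain u' where u': "u' \<noteq> v" "{v, u'} \<in> N'" using partner less.prems(3) by blast
    have uZ: "u \<in> Z" "u' \<in> Z" using u u' less.prems(2,3) by (auto simp: perfect_matching_def)
    define \<tau> where "\<tau> = Transposition.transpose u u'"
    define N1 where "N1 = relabel \<tau> N"
    have \<tau>: "\<tau> permutes Z" unfolding \<tau>_def using uZ by (intro permutes_swap_id) auto
    have N1: "perfect_matching Z N1" unfolding N1_def by (rule perfect_matching_relabel[OF \<tau> less.prems(2)])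
    have "\<tau> ` {v, u} = {v, u'}" using u(1) u'(1) by (simp add: \<tau>_def Transposition.transpose_def)
    then have in1: "{v, u'} \<in> N1" unfolding N1_def using u(2) by (metis image_eqI)
    have "\<tau> ` e = e" if "e \<in> F" for e
      unfolding \<tau>_def using that uZ less.prems(6) by (intro transpose_fixes) auto
    then have "relabel \<tau> F = F" by simp
    then have eq: "relabel \<tau> (F \<union> N) = F \<union> N1" by (simp add: N1_def image_Un)
    then have g1: "g (F \<union> N1) = g (F \<union> N)" and M1: "F \<union> N1 \<in> \<M>"
      using less.prems(4)[OF less.prems(5) uZ] unfolding \<tau>_def by simp_all
    let ?Z = "Z - {v, u'}" and ?F = "insert {v, u'} F"
    have split: "?F \<union> (N1 - {{v, u'}}) = F \<union> N1" "?F \<union> (N' - {{v, u'}}) = F \<union> N'"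
      using in1 u'(2) by auto
    have "g (?F \<union> (N1 - {{v, u'}})) = g (?F \<union> (N' - {{v, u'}}))"
    proof (rule less.hyps[where Z = ?Z])
      show "card ?Z < card Z" using v less.prems(1) by (intro psubset_card_mono) auto
      show "finite ?Z" using less.prems(1) by simp
      show "perfect_matching ?Z (N1 - {{v, u'}})" "perfect_matching ?Z (N' - {{v, u'}})"
        using perfect_matching_Diff[OF N1, of "{{v, u'}}"]
          perfect_matching_Diff[OF less.prems(3), of "{{v, u'}}"] in1 u'(2) by simp_all
      show "?F \<union> (N1 - {{v, u'}}) \<in> \<M>" using M1 split by simp
      show "\<Union>?F \<inter> ?Z = {}" using less.prems(6) by auto
    qed (use less.prems(4) in auto)
    then show ?thesis using g1 split by simp
  qed
qed

context odd_halves
begin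

text \<open>
  The summand of \<open>N\<close> depends only on the set \<open>C\<close> of edges of \<open>N\<close> that meet \<open>W\<close>, and the perfect
  matchings with the same \<open>C\<close> are those that contain \<open>C\<close>.
\<close>
lemma signed_sum_nonneg:
  fixes w :: "'a set set \<Rightarrow> real" and g :: "'a set set \<Rightarrow> real"
  assumes w: "\<And>C. (\<And>e. e \<in> C \<Longrightarrow> card e = 2) \<Longrightarrow> pairwise disjnt C \<Longrightarrow> \<Union>C \<subseteq> A \<union> B \<Longrightarrow> card C \<le> k \<Longrightarrow>
      0 \<le> (\<Sum>N | perfect_matching (A \<union> B) N \<and> C \<subseteq> N. w N)"
    and W: "finite W" "card W \<le> k" and R: "\<Union>R \<inter> (A \<union> B) = {}"
    and \<M>: "\<And>N. perfect_matching (A \<union> B) N \<Longrightarrow> R \<union> N \<in> \<M>"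
    and g: "\<And>M. M \<in> \<M> \<Longrightarrow> g M \<ge> 0"
    and inv: "\<And>M a b. M \<in> \<M> \<Longrightarrow> a \<in> A \<union> B - W \<Longrightarrow> b \<in> A \<union> B - W \<Longrightarrow>
      relabel (Transposition.transpose a b) M \<in> \<M> \<and> g (relabel (Transposition.transpose a b) M) = g M"
  shows "0 \<le> (\<Sum>N | perfect_matching (A \<union> B) N. w N * g (R \<union> N))"
proof -
  define P where "P = {N. perfect_matching (A \<union> B) N}"
  define c where "c N = {e \<in> N. e \<inter> W \<noteq> {}}" for N :: "'a set set"
  have finP: "finite P" unfolding P_def using finite_perfect_matchings[of "A \<union> B"] fin by simp
  have "(\<Sum>N\<in>P. w N * g (R \<union> N)) = (\<Sum>C\<in>c ` P. \<Sum>N | N \<in> P \<and> c N = C. w N * g (R \<union> N))"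
    by (rule sum.image_gen[OF finP])
  also have "\<dots> \<ge> 0"
  proof (rule sum_nonneg)
    fix C assume "C \<in> c ` P"
    then obtain N0 where N0: "perfect_matching (A \<union> B) N0" and C: "C = c N0" by (auto simp: P_def)
    have CN0: "C \<subseteq> N0" by (auto simp: C c_def)
    have C': "\<And>e. e \<in> C \<Longrightarrow> card e = 2" "pairwise disjnt C" "\<Union>C \<subseteq> A \<union> B" "card C \<le> k"
      using N0 CN0 card_edges_meeting_le[of N0 W] W
      by (auto simp: perfect_matching_def pairwise_subset C c_def[symmetric])
    \<comment> \<open>Every node of \<open>A \<union> B\<close> that lies in \<open>W\<close> is
      covered by \<open>C\<close>. A perfect matching that contains \<open>C\<close> thus has no
      further edge meeting \<open>W\<close>, and the transpositions that rearrange its other edges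
      avoid \<open>W\<close>.\<close>
    have cover: "x \<in> \<Union>C" if "x \<in> W" "x \<in> A \<union> B" for x
    proof -
      have "x \<in> \<Union>N0" using that(2) N0 by (simp add: perfect_matching_def)
      then show ?thesis using that(1) by (auto simp: C c_def)
    qed
    have fiber: "c N = C \<longleftrightarrow> C \<subseteq> N" if N: "perfect_matching (A \<union> B) N" for N
    proof
      assume "c N = C" then show "C \<subseteq> N" by (auto simp: c_def)
    next
      assume sub: "C \<subseteq> N"
      show "c N = C"
      proof
        show "C \<subseteq> c N" using sub by (auto simp: C c_def)
        show "c N \<subseteq> C"
        proof
          fix e assume "e \<in> c N"
          then obtain x where e: "e \<in> N" "x \<in> e" "x \<in> W" by (auto simp: c_def)
          then have "x \<in> A \<union> B" using N by (auto simp: perfect_matching_def)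
          then obtain e' where e': "e' \<in> C" "x \<in> e'" using cover e(3) by blast
          then have "e' \<in> N" using sub by blast
          then have "e = e'" using N e e'(2) by (auto simp: perfect_matching_def pairwise_def disjnt_def)
          then show "e \<in> C" using e' by simp
        qed
      qed
    qed
    have const: "g (R \<union> N) = g (R \<union> N0)" if N: "perfect_matching (A \<union> B) N" "C \<subseteq> N" for N
    proof -
      have ZW: "A \<union> B - \<Union>C \<subseteq> A \<union> B - W" using cover by blast
      have split: "(R \<union> C) \<union> (N - C) = R \<union> N" "(R \<union> C) \<union> (N0 - C) = R \<union> N0" using N(2) CN0 by auto
      have "g ((R \<union> C) \<union> (N - C)) = g ((R \<union> C) \<union> (N0 - C))"
      proof (rule invariant_on_perfect_matchings[where Z = "A \<union> B - \<Union>C" and \<M> = \<M>])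
        show "finite (A \<union> B - \<Union>C)" using fin by simp
        show "perfect_matching (A \<union> B - \<Union>C) (N - C)" by (rule perfect_matching_Diff[OF N])
        show "perfect_matching (A \<union> B - \<Union>C) (N0 - C)" by (rule perfect_matching_Diff[OF N0 CN0])
        show "R \<union> C \<union> (N - C) \<in> \<M>" unfolding split by (rule \<M>[OF N(1)])
        show "\<Union>(R \<union> C) \<inter> (A \<union> B - \<Union>C) = {}" using R by auto
      qed (use inv ZW in blast)
      then show ?thesis unfolding split .
    qed
    have "{N \<in> P. c N = C} = {N. perfect_matching (A \<union> B) N \<and> C \<subseteq> N}"
      using fiber by (auto simp: P_def)
    then have "(\<Sum>N | N \<in> P \<and> c N = C. w N * g (R \<union> N)) =
        (\<Sum>N | perfect_matching (A \<union> B) N \<and> C \<subseteq> N. w N * g (R \<union> N0))"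
      by (intro sum.cong) (auto simp: const)
    also have "\<dots> = (\<Sum>N | perfect_matching (A \<union> B) N \<and> C \<subseteq> N. w N) * g (R \<union> N0)"
      by (simp add: sum_distrib_right)
    also have "\<dots> \<ge> 0" using w[OF C'] g[OF \<M>[OF N0]] by simp
    finally show "0 \<le> (\<Sum>N | N \<in> P \<and> c N = C. w N * g (R \<union> N))" .
  qed
  finally show ?thesis by (simp add: P_def)
qed

end

lemma relabel_matchings:
  assumes "\<pi> permutes {1..n}" "M \<in> matchings l n"
  shows "relabel \<pi> M \<in> matchings l n"
proof -
  have inj: "inj \<pi>" using assms(1) by (rule permutes_inj)
  have c: "card (\<pi> ` e) = card e" for e using inj by (meson card_image inj_on_subset subset_UNIV)
  have "\<pi> ` e \<subseteq> {1..n}" if "e \<subseteq> {1..n}" for e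
    using permutes_image[OF assms(1)] image_mono[OF that, of \<pi>] by simp
  then have "relabel \<pi> M \<subseteq> edges n" using assms(2) c by (auto simp: matchings_def edges_def)
  moreover have "card (relabel \<pi> M) = card M"
    using inj by (intro card_image) (meson inj_image_eq_iff inj_onI)
  ultimately show ?thesis
    using assms(2) pairwise_disjnt_relabel[OF inj] by (simp add: matchings_def)
qed

text \<open>
  A transposition \<open>(a b)\<close> acts on \<open>M\<close> like the even permutation \<open>(a b) (u v)\<close> if \<open>{u, v}\<close> is an
  edge of \<open>M\<close>.
\<close>
lemma (in small_index_subgroup) transpose_invariant:
  assumes D: "alternating_on D" "D \<subseteq> V" and ab: "a \<in> D" "b \<in> D" "a \<noteq> b"
    and M: "pairwise disjnt M" "\<And>e. e \<in> M \<Longrightarrow> card e = 2 \<and> e \<subseteq> V" "card (V - D) + 2 < card M"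
  obtains \<pi> where "\<pi> \<in> U" "relabel \<pi> M = relabel (Transposition.transpose a b) M"
proof -
  \<comment> \<open>Each node of \<open>?X\<close> spoils at most one edge of \<open>M\<close>, so
    that an edge inside \<open>D\<close> avoiding \<open>a\<close> and \<open>b\<close>
    remains.\<close>
  let ?X = "insert a (insert b (V - D))"
  have fX: "finite ?X" using finite_V by simp
  have "card ?X \<le> card (V - D) + 2"
    using finite_V by (simp add: card_insert_if)
  then have "card {e \<in> M. e \<inter> ?X \<noteq> {}} < card M"
    using card_edges_meeting_le[OF M(1) fX] M(3) by linarith
  then have "{e \<in> M. e \<inter> ?X \<noteq> {}} \<noteq> M" by (metis less_irrefl)
  then obtain e where e: "e \<in> M" "e \<inter> ?X = {}" by blast
  then obtain u v where uv: "e = {u, v}" "u \<noteq> v" using M(2) by (metis card_2_iff)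
  have D': "u \<in> D" "v \<in> D" "u \<noteq> a" "u \<noteq> b" "v \<noteq> a" "v \<noteq> b" using e M(2)[OF e(1)] uv by auto
  have "cyc3 a b u \<circ> cyc3 b u v \<in> U"
    using D' ab uv by (intro U_comp alternating_onD[OF D(1)]) auto
  moreover have "cyc3 a b u \<circ> cyc3 b u v = Transposition.transpose a b \<circ> Transposition.transpose u v"
    using D' ab uv by (auto simp: fun_eq_iff cyc3_def Transposition.transpose_def)
  moreover have "relabel (Transposition.transpose u v) M = M"
  proof -
    have "Transposition.transpose u v ` e' = e'" if "e' \<in> M" for e'
    proof (cases "e' = e")
      case True then show ?thesis using uv by (auto simp: Transposition.transpose_def)
    next
      case False
      then have "e \<inter> e' = {}" using M(1) e(1) that by (auto simp: pairwise_def disjnt_def)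
      then show ?thesis using uv by (intro transpose_fixes) auto
    qed
    then show ?thesis by simp
  qed
  ultimately show ?thesis using that relabel_comp by metis
qed

subsection \<open>Symmetric extended formulations\<close>

definition slack :: "'e formulation \<Rightarrow> nat \<Rightarrow> real vec \<Rightarrow> real" where
  "slack F j y = le_rhs F $ j - (le_mat F *\<^sub>v y) $ j"

lemma permute_vec_index: "i < dim_vec y \<Longrightarrow> permute_vec \<sigma> y $ i = y $ inv_into UNIV \<sigma> i"
  by (simp add: permute_vec_def)

lemma dim_permute_vec [simp]: "dim_vec (permute_vec \<sigma> y) = dim_vec y"
  by (simp add: permute_vec_def)

lemma permute_vec_comp:
  assumes "\<kappa> permutes {..<d}" "\<sigma> permutes {..<d}" "y \<in> carrier_vec d"
  shows "permute_vec \<kappa> (permute_vec \<sigma> y) = permute_vec (\<kappa> \<circ> \<sigma>) y"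
proof
  fix i assume i: "i < dim_vec (permute_vec (\<kappa> \<circ> \<sigma>) y)"
  have "inv_into UNIV \<kappa> i < d"
    using permutes_in_image[OF permutes_inv[OF assms(1)], of i] i assms(3) by simp
  moreover have "inv_into UNIV (\<kappa> \<circ> \<sigma>) = inv_into UNIV \<sigma> \<circ> inv_into UNIV \<kappa>"
    using assms(1,2) by (intro o_inv_distrib permutes_bij)
  ultimately show "permute_vec \<kappa> (permute_vec \<sigma> y) $ i = permute_vec (\<kappa> \<circ> \<sigma>) y $ i"
    using i assms(3) by (simp add: permute_vec_index)
qed simp

lemma inj_on_permute_vec:
  assumes "\<kappa> permutes {..<d}"
  shows "inj_on (permute_vec \<kappa>) (carrier_vec d)"
proof (rule inj_onI, rule eq_vecI)
  fix x y :: "'a vec" and i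
  assume xy: "x \<in> carrier_vec d" "y \<in> carrier_vec d" "permute_vec \<kappa> x = permute_vec \<kappa> y" and "i < dim_vec y"
  then have "\<kappa> i < d" using permutes_in_image[OF assms, of i] by simp
  then have "x $ inv_into UNIV \<kappa> (\<kappa> i) = y $ inv_into UNIV \<kappa> (\<kappa> i)"
    using xy permute_vec_index by (metis carrier_vecD)
  then show "x $ i = y $ i" using permutes_inverses(2)[OF assms] by simp
qed simp

lemma permute_mult_mat_vec:
  fixes A :: "real mat"
  assumes A: "A \<in> carrier_mat m d" "permute_mat \<rho> \<kappa> A = A" and y: "y \<in> carrier_vec d"
    and \<rho>: "\<rho> permutes {..<m}" and \<kappa>: "\<kappa> permutes {..<d}" and i: "i < m"
  shows "(A *\<^sub>v permute_vec \<kappa> y) $ \<rho> i = (A *\<^sub>v y) $ i"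
proof -
  have \<rho>i: "\<rho> i < m" using permutes_in_image[OF \<rho>, of i] i by simp
  have entry: "A $$ (\<rho> i, t) = A $$ (i, inv_into UNIV \<kappa> t)" if "t < d" for t
  proof -
    have "A $$ (\<rho> i, t) = permute_mat \<rho> \<kappa> A $$ (\<rho> i, t)" by (simp add: A(2))
    also have "\<dots> = A $$ (inv_into UNIV \<rho> (\<rho> i), inv_into UNIV \<kappa> t)"
      using A(1) \<rho>i that by (simp add: permute_mat_def)
    finally show ?thesis using permutes_inverses(2)[OF \<rho>] by simp
  qed
  have "(A *\<^sub>v permute_vec \<kappa> y) $ \<rho> i = (\<Sum>t<d. A $$ (\<rho> i, t) * y $ inv_into UNIV \<kappa> t)"
    using A(1) y \<rho>i by (simp add: scalar_prod_def permute_vec_index atLeast0LessThan)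
  also have "\<dots> = (\<Sum>t<d. A $$ (i, inv_into UNIV \<kappa> t) * y $ inv_into UNIV \<kappa> t)"
    by (intro sum.cong) (auto simp: entry)
  also have "\<dots> = (\<Sum>t<d. A $$ (i, t) * y $ t)"
    using sum.permute[OF permutes_inv[OF \<kappa>], of "\<lambda>t. A $$ (i, t) * y $ t"] by (simp add: comp_def)
  also have "\<dots> = (A *\<^sub>v y) $ i"
    using A(1) y i by (simp add: scalar_prod_def atLeast0LessThan)
  finally show ?thesis .
qed

lemma permuted_rhs:
  assumes "permute_vec \<rho> b = b" "\<rho> permutes {..<dim_vec b}" "i < dim_vec b"
  shows "b $ \<rho> i = b $ i"
proof -
  have "\<rho> i < dim_vec b" using permutes_in_image[OF assms(2), of i] assms(3) by simp
  then have "permute_vec \<rho> b $ \<rho> i = b $ inv_into UNIV \<rho> (\<rho> i)" by (rule permute_vec_index)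
  then show ?thesis using assms(1) permutes_inverses(2)[OF assms(2)] by simp
qed

lemma well_formed_dims:
  assumes "well_formed E F"
  shows "eq_mat F \<in> carrier_mat (dim_vec (eq_rhs F)) (nvars F)"
    "le_mat F \<in> carrier_mat (dim_vec (le_rhs F)) (nvars F)"
    "dim_row (eq_mat F) = dim_vec (eq_rhs F)" "dim_row (le_mat F) = dim_vec (le_rhs F)"
    "form_size F = dim_vec (le_rhs F)"
  using assms by (auto simp: well_formed_def form_size_def)

lemma solutions_iff:
  assumes "well_formed E F"
  shows "y \<in> solutions F \<longleftrightarrow> y \<in> carrier_vec (nvars F) \<and>
    (\<forall>i<dim_vec (eq_rhs F). (eq_mat F *\<^sub>v y) $ i = eq_rhs F $ i) \<and> (\<forall>j<form_size F. slack F j y \<ge> 0)"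
proof -
  note dims = well_formed_dims[OF assms]
  have "eq_mat F *\<^sub>v y = eq_rhs F \<longleftrightarrow>
      (\<forall>i<dim_vec (eq_rhs F). (eq_mat F *\<^sub>v y) $ i = eq_rhs F $ i)"
    by (metis dim_mult_mat_vec dims(3) eq_vecI)
  moreover have "le_mat F *\<^sub>v y \<le> le_rhs F \<longleftrightarrow> (\<forall>j<form_size F. slack F j y \<ge> 0)"
    by (simp only: less_eq_vec_def slack_def dim_mult_mat_vec dims(4,5) diff_ge_0_iff_ge simp_thms)
  ultimately show ?thesis unfolding solutions_def by blast
qed

text \<open>As the system is invariant, rearranging the coordinates of a point by
  \<open>\<kappa>\<close> only rearranges the values of its rows.\<close>

lemma permuted_solution:
  assumes wf: "well_formed E F" and y: "y \<in> solutions F"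
    and \<kappa>: "\<kappa> permutes {..<nvars F}"
    and \<rho>e: "\<rho>e permutes {..<dim_row (eq_mat F)}" and \<rho>: "\<rho> permutes {..<dim_row (le_mat F)}"
    and eq: "permute_mat \<rho>e \<kappa> (eq_mat F) = eq_mat F" "permute_vec \<rho>e (eq_rhs F) = eq_rhs F"
    and le: "permute_mat \<rho> \<kappa> (le_mat F) = le_mat F" "permute_vec \<rho> (le_rhs F) = le_rhs F"
  shows "j < form_size F \<Longrightarrow> slack F (\<rho> j) (permute_vec \<kappa> y) = slack F j y"
    and "permute_vec \<kappa> y \<in> solutions F"
proof -
  note dims = well_formed_dims[OF wf]
  have yc: "y \<in> carrier_vec (nvars F)" using y by (simp add: solutions_def)
  have sl: "slack F (\<rho> j) (permute_vec \<kappa> y) = slack F j y" if "j < form_size F" for j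
    using permute_mult_mat_vec[OF dims(2) le(1) yc] permuted_rhs[OF le(2)] \<rho> \<kappa> that dims
    by (simp add: slack_def)
  then show "j < form_size F \<Longrightarrow> slack F (\<rho> j) (permute_vec \<kappa> y) = slack F j y" .
  have "(eq_mat F *\<^sub>v permute_vec \<kappa> y) $ i = eq_rhs F $ i" if i: "i < dim_vec (eq_rhs F)" for i
  proof -
    define i' where "i' = inv_into UNIV \<rho>e i"
    have i': "i' < dim_vec (eq_rhs F)"
      using permutes_in_image[OF permutes_inv[OF \<rho>e], of i] i dims(3) by (simp add: i'_def)
    have "i = \<rho>e i'" using permutes_inverses(1)[OF \<rho>e] by (simp add: i'_def)
    then have "(eq_mat F *\<^sub>v permute_vec \<kappa> y) $ i = (eq_mat F *\<^sub>v y) $ i'"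
      using permute_mult_mat_vec[OF dims(1) eq(1) yc] \<rho>e \<kappa> dims(3) i' by simp
    also have "\<dots> = eq_rhs F $ i'" using y i' solutions_iff[OF wf] by simp
    also have "\<dots> = eq_rhs F $ i"
      using permuted_rhs[OF eq(2)] \<rho>e dims(3) i' \<open>i = \<rho>e i'\<close> by simp
    finally show ?thesis .
  qed
  moreover have "slack F j (permute_vec \<kappa> y) \<ge> 0" if j: "j < form_size F" for j
  proof -
    define j' where "j' = inv_into UNIV \<rho> j"
    have j': "j' < form_size F"
      using permutes_in_image[OF permutes_inv[OF \<rho>], of j] j dims(4,5) by (simp add: j'_def)
    have "j = \<rho> j'" using permutes_inverses(1)[OF \<rho>] by (simp add: j'_def)
    then have "slack F j (permute_vec \<kappa> y) = slack F j' y" using sl[OF j'] by simp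
    then show ?thesis using y j' solutions_iff[OF wf] by simp
  qed
  moreover have "permute_vec \<kappa> y \<in> carrier_vec (nvars F)"
    using yc by (intro carrier_vecI) simp
  ultimately show "permute_vec \<kappa> y \<in> solutions F"
    unfolding solutions_iff[OF wf] by blast
qed

text \<open>The weights may be negative. Equations survive every affine combination, and since the
  weights sum to 1, the slack at the combined point is the combination of the slacks, which
  \<open>pos\<close> controls.\<close>

lemma affine_combination_solution:
  assumes wf: "well_formed E F" and fin: "finite \<Omega>" and y: "\<And>i. i \<in> \<Omega> \<Longrightarrow> y i \<in> solutions F"
    and w: "(\<Sum>i\<in>\<Omega>. w i) = 1" and pos: "\<And>j. j < form_size F \<Longrightarrow> 0 \<le> (\<Sum>i\<in>\<Omega>. w i * slack F j (y i))"
  shows "(\<lambda>e. \<Sum>i\<in>\<Omega>. w i * projection E F (y i) e) \<in> projection E F ` solutions F"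
proof
  note dims = well_formed_dims[OF wf]
  define z where "z = vec (nvars F) (\<lambda>t. \<Sum>i\<in>\<Omega>. w i * y i $ t)"
  have zc: "z \<in> carrier_vec (nvars F)" by (simp add: z_def)
  have yc: "dim_vec (y i) = nvars F" if "i \<in> \<Omega>" for i using y[OF that] by (simp add: solutions_def)
  have lin: "r \<bullet> z = (\<Sum>i\<in>\<Omega>. w i * (r \<bullet> y i))" if "r \<in> carrier_vec (nvars F)" for r
  proof -
    have "r \<bullet> z = (\<Sum>t<nvars F. \<Sum>i\<in>\<Omega>. w i * (r $ t * y i $ t))"
      by (simp add: scalar_prod_def z_def sum_distrib_left atLeast0LessThan ac_simps)
    also have "\<dots> = (\<Sum>i\<in>\<Omega>. \<Sum>t<nvars F. w i * (r $ t * y i $ t))" by (rule sum.swap)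
    also have "\<dots> = (\<Sum>i\<in>\<Omega>. w i * (r \<bullet> y i))"
      by (intro sum.cong refl) (simp add: scalar_prod_def sum_distrib_left atLeast0LessThan yc)
    finally show ?thesis .
  qed
  have row: "(A *\<^sub>v z) $ i = (\<Sum>l\<in>\<Omega>. w l * (A *\<^sub>v y l) $ i)"
    if "A \<in> carrier_mat m (nvars F)" "i < m" for A m i
    using that lin[of "row A i"] by auto
  have const: "(\<Sum>i\<in>\<Omega>. w i * c) = c" for c
    using w by (simp add: sum_distrib_right[symmetric])
  have "(eq_mat F *\<^sub>v z) $ i = eq_rhs F $ i" if "i < dim_vec (eq_rhs F)" for i
  proof -
    have "(eq_mat F *\<^sub>v z) $ i = (\<Sum>l\<in>\<Omega>. w l * eq_rhs F $ i)"
      unfolding row[OF dims(1) that] using y that solutions_iff[OF wf] by (intro sum.cong) auto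
    then show ?thesis by (simp only: const)
  qed
  moreover have "slack F j z \<ge> 0" if j: "j < form_size F" for j
  proof -
    have "slack F j z = (\<Sum>i\<in>\<Omega>. w i * le_rhs F $ j) - (\<Sum>i\<in>\<Omega>. w i * (le_mat F *\<^sub>v y i) $ j)"
      unfolding slack_def const using row[OF dims(2)] j dims(5) by simp
    also have "\<dots> = (\<Sum>i\<in>\<Omega>. w i * slack F j (y i))"
      by (simp add: slack_def right_diff_distrib sum_subtractf)
    finally show ?thesis using pos[OF j] by simp
  qed
  ultimately show "z \<in> solutions F" using zc by (simp add: solutions_iff[OF wf])
  show "(\<lambda>e. \<Sum>i\<in>\<Omega>. w i * projection E F (y i) e) = projection E F z"
  proof
    fix e
    show "(\<Sum>i\<in>\<Omega>. w i * projection E F (y i) e) = projection E F z e"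
    proof (cases "e \<in> E")
      case True
      then have "proj_row F e \<in> carrier_vec (nvars F)" using wf by (simp add: well_formed_def)
      then show ?thesis
        using True by (simp add: projection_def lin distrib_left sum.distrib const)
    next
      case False then show ?thesis by (simp add: projection_def)
    qed
  qed
qed

section \<open>Equivariant fibres and stabilisers of slack functions\<close>

lemma finite_matchings: "finite (matchings l n)"
  by (rule finite_subset[of _ "Pow (Pow {1..n})"]) (auto simp: matchings_def edges_def)

lemma node_action_char_vec:
  assumes "\<pi> permutes {1..n}"
  shows "node_action \<pi> (char_vec M) = char_vec (relabel \<pi> M)"
proof
  fix e
  have b: "bij \<pi>" using assms by (rule permutes_bij)
  have "inv_into UNIV \<pi> ` e \<in> M \<longleftrightarrow> e \<in> relabel \<pi> M"
  proof
    assume "inv_into UNIV \<pi> ` e \<in> M"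
    moreover have "e = \<pi> ` (inv_into UNIV \<pi> ` e)" using b by (simp add: bij_is_surj image_f_inv_f)
    ultimately show "e \<in> relabel \<pi> M" by blast
  next
    assume "e \<in> relabel \<pi> M"
    then show "inv_into UNIV \<pi> ` e \<in> M" using b by (auto simp: image_comp comp_def bij_is_inj)
  qed
  then show "node_action \<pi> (char_vec M) e = char_vec (relabel \<pi> M) e"
    by (simp add: node_action_def char_vec_def indicator_def)
qed

text \<open>
  Since \<open>\<kappa>\<close> need not be a homomorphism, an equivariant section of the projection is not found by
  averaging over a group. Instead each matching gets the finite set of all solutions above it that
  are rearrangements of fixed representatives.
\<close>
lemma equivariant_fibers:
  assumes ef: "extended_formulation (edges n) (match_polytope l n) F"
    and sym: "symmetric_formulation (edges n) (node_group n) F"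
  shows "\<exists>T. (\<forall>M\<in>matchings l n. finite (T M) \<and> T M \<noteq> {}) \<and>
    (\<forall>M\<in>matchings l n. \<forall>y\<in>T M. y \<in> solutions F \<and> projection (edges n) F y = char_vec M) \<and>
    (\<forall>\<pi>. \<pi> permutes {1..n} \<longrightarrow> (\<exists>\<kappa> \<rho>. \<rho> permutes {..<form_size F} \<and>
       (\<forall>M\<in>matchings l n. bij_betw (permute_vec \<kappa>) (T M) (T (relabel \<pi> M))) \<and>
       (\<forall>j<form_size F. \<forall>y\<in>solutions F. slack F (\<rho> j) (permute_vec \<kappa> y) = slack F j y)))"
proof -
  define E where "E = edges n"
  define d where "d = nvars F"
  have wf: "well_formed E F" and proj: "projection E F ` solutions F = match_polytope l n"
    using ef by (auto simp: extended_formulation_def E_def)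
  have "char_vec M \<in> match_polytope l n" if "M \<in> matchings l n" for M
    unfolding match_polytope_def using that by (intro hull_inc) simp
  then have "\<exists>y. y \<in> solutions F \<and> projection E F y = char_vec M" if "M \<in> matchings l n" for M
    using proj that by (metis (no_types, lifting) imageE)
  then obtain y0 where y0: "\<And>M. M \<in> matchings l n \<Longrightarrow> y0 M \<in> solutions F \<and> projection E F (y0 M) = char_vec M"
    by metis
  \<comment> \<open>Closing the representatives under all coordinate permutations makes the set
    stable under every \<open>\<kappa>\<close> that may occur, and it stays finite.\<close>
  define orb where "orb = (\<Union>M\<in>matchings l n. (\<lambda>\<kappa>. permute_vec \<kappa> (y0 M)) ` {\<kappa>. \<kappa> permutes {..<d}})"
  have finorb: "finite orb"
    unfolding orb_def using finite_matchings by (intro finite_UN_I finite_imageI finite_permutations) auto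
  define T where "T M = {y \<in> orb. y \<in> solutions F \<and> projection E F y = char_vec M}" for M
  have carrier: "y \<in> carrier_vec d" if "y \<in> solutions F" for y
    using that by (simp add: solutions_def d_def)
  have finT: "finite (T M)" for M using finorb by (simp add: T_def)
  have neT: "T M \<noteq> {}" if M: "M \<in> matchings l n" for M
  proof -
    have "permute_vec id (y0 M) = y0 M" by (rule eq_vecI) (simp_all add: permute_vec_index inv_id)
    then have "y0 M \<in> orb" using M permutes_id unfolding orb_def by (metis (mono_tags, lifting) UN_I image_eqI mem_Collect_eq)
    then show ?thesis using y0[OF M] by (auto simp: T_def)
  qed
  have each: "\<exists>\<kappa> \<rho>. \<rho> permutes {..<form_size F} \<and> inj_on (permute_vec \<kappa>) (carrier_vec d :: real vec set) \<and>
       (\<forall>M\<in>matchings l n. permute_vec \<kappa> ` T M \<subseteq> T (relabel \<pi> M)) \<and>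
       (\<forall>j<form_size F. \<forall>y\<in>solutions F. slack F (\<rho> j) (permute_vec \<kappa> y) = slack F j y)"
    if \<pi>: "\<pi> permutes {1..n}" for \<pi>
  proof -
    have "node_action \<pi> \<in> node_group n" using \<pi> by (simp add: node_group_def)
    then obtain \<kappa> \<rho>e \<rho> where \<kappa>: "\<kappa> permutes {..<nvars F}"
      and \<rho>: "\<rho>e permutes {..<dim_row (eq_mat F)}" "\<rho> permutes {..<dim_row (le_mat F)}"
      and pr: "\<forall>y\<in>solutions F. projection E F (permute_vec \<kappa> y) = node_action \<pi> (projection E F y)"
      and inv: "permute_mat \<rho>e \<kappa> (eq_mat F) = eq_mat F" "permute_vec \<rho>e (eq_rhs F) = eq_rhs F"
        "permute_mat \<rho> \<kappa> (le_mat F) = le_mat F" "permute_vec \<rho> (le_rhs F) = le_rhs F"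
      using sym unfolding symmetric_formulation_def E_def by blast
    have sol: "permute_vec \<kappa> y \<in> solutions F" if "y \<in> solutions F" for y
      using permuted_solution(2)[OF wf that \<kappa> \<rho> inv] .
    have "permute_vec \<kappa> y \<in> T (relabel \<pi> M)" if "y \<in> T M" for y M
    proof -
      have y: "y \<in> orb" "y \<in> solutions F" "projection E F y = char_vec M" using that by (auto simp: T_def)
      obtain M' \<sigma> where s: "M' \<in> matchings l n" "\<sigma> permutes {..<d}" "y = permute_vec \<sigma> (y0 M')"
        using y(1) by (auto simp: orb_def)
      have "permute_vec \<kappa> y = permute_vec (\<kappa> \<circ> \<sigma>) (y0 M')"
        unfolding s(3) using \<kappa> s y0 carrier by (intro permute_vec_comp) (auto simp: d_def)
      moreover have "\<kappa> \<circ> \<sigma> permutes {..<d}" using permutes_compose[OF s(2)] \<kappa> by (simp add: d_def)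
      ultimately have "permute_vec \<kappa> y \<in> orb" using s(1) by (auto simp: orb_def)
      moreover have "projection E F (permute_vec \<kappa> y) = char_vec (relabel \<pi> M)"
        using pr y(2,3) node_action_char_vec[OF \<pi>] by simp
      ultimately show ?thesis using sol[OF y(2)] by (simp add: T_def)
    qed
    moreover have "\<forall>j<form_size F. \<forall>y\<in>solutions F. slack F (\<rho> j) (permute_vec \<kappa> y) = slack F j y"
      using permuted_solution(1)[OF wf _ \<kappa> \<rho> inv] by blast
    moreover have "inj_on (permute_vec \<kappa>) (carrier_vec d :: real vec set)"
      using inj_on_permute_vec \<kappa> by (simp add: d_def)
    ultimately have "\<rho> permutes {..<form_size F} \<and> inj_on (permute_vec \<kappa>) (carrier_vec d :: real vec set) \<and>
       (\<forall>M\<in>matchings l n. permute_vec \<kappa> ` T M \<subseteq> T (relabel \<pi> M)) \<and>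
       (\<forall>j<form_size F. \<forall>y\<in>solutions F. slack F (\<rho> j) (permute_vec \<kappa> y) = slack F j y)"
      using \<rho>(2) unfolding form_size_def by blast
    then show ?thesis by (intro exI)
  qed
  have card_le: "card (T M) \<le> card (T (relabel \<pi> M))" if \<pi>: "\<pi> permutes {1..n}" and M: "M \<in> matchings l n" for \<pi> M
  proof -
    obtain \<kappa> where "inj_on (permute_vec \<kappa>) (carrier_vec d :: real vec set)" "permute_vec \<kappa> ` T M \<subseteq> T (relabel \<pi> M)"
      using each[OF \<pi>] M by blast
    moreover have "T M \<subseteq> carrier_vec d" using carrier by (auto simp: T_def)
    ultimately show ?thesis using finT by (meson card_inj_on_le inj_on_subset)
  qed
  have sym': "\<exists>\<kappa> \<rho>. \<rho> permutes {..<form_size F} \<and>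
       (\<forall>M\<in>matchings l n. bij_betw (permute_vec \<kappa>) (T M) (T (relabel \<pi> M))) \<and>
       (\<forall>j<form_size F. \<forall>y\<in>solutions F. slack F (\<rho> j) (permute_vec \<kappa> y) = slack F j y)"
    if \<pi>: "\<pi> permutes {1..n}" for \<pi>
  proof -
    obtain \<kappa> \<rho> where *: "\<rho> permutes {..<form_size F}" "inj_on (permute_vec \<kappa>) (carrier_vec d :: real vec set)"
       "\<forall>M\<in>matchings l n. permute_vec \<kappa> ` T M \<subseteq> T (relabel \<pi> M)"
       "\<forall>j<form_size F. \<forall>y\<in>solutions F. slack F (\<rho> j) (permute_vec \<kappa> y) = slack F j y"
      using each[OF \<pi>] by blast
    have "bij_betw (permute_vec \<kappa>) (T M) (T (relabel \<pi> M))" if M: "M \<in> matchings l n" for M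
    proof -
      have "T M \<subseteq> carrier_vec d" using carrier by (auto simp: T_def)
      then have inj: "inj_on (permute_vec \<kappa>) (T M)" by (rule inj_on_subset[OF *(2)])
      \<comment> \<open>The reverse inequality uses the inverse of \<open>\<pi>\<close> with a
        coordinate permutation of its own, which need not be the inverse of
        \<open>\<kappa>\<close>.\<close>
      have "card (T (relabel \<pi> M)) \<le> card (T (relabel (inv_into UNIV \<pi>) (relabel \<pi> M)))"
        by (rule card_le[OF permutes_inv[OF \<pi>] relabel_matchings[OF \<pi> M]])
      also have "\<dots> = card (T M)" by (simp only: relabel_inv[OF permutes_bij[OF \<pi>]])
      also have "\<dots> = card (permute_vec \<kappa> ` T M)" using inj by (simp add: card_image)
      finally have "permute_vec \<kappa> ` T M = T (relabel \<pi> M)"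
        using *(3) M finT by (intro card_seteq) auto
      then show ?thesis using inj by (simp add: bij_betw_def)
    qed
    then show ?thesis using * by blast
  qed
  have "\<forall>M\<in>matchings l n. finite (T M) \<and> T M \<noteq> {}" using finT neT by simp
  moreover have "\<forall>M\<in>matchings l n. \<forall>y\<in>T M. y \<in> solutions F \<and> projection (edges n) F y = char_vec M"
    by (simp add: T_def E_def)
  ultimately show ?thesis using sym' by (intro exI[of _ T] conjI allI impI)
qed

text \<open>
  The stabiliser of each \<open>S j\<close> has index at most \<open>f\<close>, because \<open>S j\<close> has at most \<open>f\<close> images.
\<close>
lemma alternating_stabilizer:
  fixes S :: "nat \<Rightarrow> nat set set \<Rightarrow> real"
  assumes sym: "\<And>\<pi>. \<pi> permutes {1..n} \<Longrightarrow> \<exists>\<rho>. \<rho> permutes {..<f} \<and>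
      (\<forall>i<f. \<forall>M\<in>matchings l n. S (\<rho> i) (relabel \<pi> M) = S i M)"
    and j: "j < f" and "f < 2 ^ Suc r" "12 * r + 2 \<le> n" "f < n choose Suc k" "k + 2 < l"
  obtains W where "W \<subseteq> {1..n}" "card W \<le> k"
    "\<And>M a b. M \<in> matchings l n \<Longrightarrow> a \<in> {1..n} - W \<Longrightarrow> b \<in> {1..n} - W \<Longrightarrow>
      S j (relabel (Transposition.transpose a b) M) = S j M"
proof -
  define V where "V = {1..n}"
  \<comment> \<open>Fixing the values of \<open>S j\<close> is closed under composition; the
    condition \<open>\<rho> \<pi> j = j\<close> might not be, as \<open>\<rho>\<close> is a mere
    choice.\<close>
  define U where "U = {\<pi>. \<pi> permutes V \<and> (\<forall>M\<in>matchings l n. S j (relabel \<pi> M) = S j M)}"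
  have "\<exists>\<rho>. \<forall>\<pi>. \<pi> permutes V \<longrightarrow> \<rho> \<pi> permutes {..<f} \<and>
      (\<forall>i<f. \<forall>M\<in>matchings l n. S (\<rho> \<pi> i) (relabel \<pi> M) = S i M)"
    using sym unfolding V_def by metis
  then obtain \<rho> where \<rho>: "\<And>\<pi>. \<pi> permutes V \<Longrightarrow> \<rho> \<pi> permutes {..<f}"
    "\<And>\<pi> M. \<pi> permutes V \<Longrightarrow> M \<in> matchings l n \<Longrightarrow> S (\<rho> \<pi> j) (relabel \<pi> M) = S j M"
    using j by blast
  have rel: "relabel \<pi> M \<in> matchings l n" if "\<pi> permutes V" "M \<in> matchings l n" for \<pi> M
    using relabel_matchings that by (simp add: V_def)
  have undo: "relabel \<pi> (relabel (inv_into UNIV \<pi>) M) = M" if "\<pi> permutes V" for \<pi> M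
    unfolding relabel_comp[symmetric] permutes_inv_o(1)[OF that] by simp
  interpret small_index_subgroup V U f "\<lambda>\<pi>. \<rho> \<pi> j"
  proof
    show "finite V" by (simp add: V_def)
    show "\<pi> permutes V" if "\<pi> \<in> U" for \<pi> using that by (simp add: U_def)
    show "\<pi> \<circ> \<sigma> \<in> U" if "\<pi> \<in> U" "\<sigma> \<in> U" for \<pi> \<sigma>
    proof -
      have p: "\<pi> permutes V" "\<sigma> permutes V" using that by (auto simp: U_def)
      have "S j (relabel (\<pi> \<circ> \<sigma>) M) = S j M" if M: "M \<in> matchings l n" for M
        using \<open>\<pi> \<in> U\<close> \<open>\<sigma> \<in> U\<close> rel[OF p(2) M] M unfolding relabel_comp by (simp add: U_def)
      then show ?thesis using permutes_compose[OF p(2,1)] by (simp add: U_def)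
    qed
    show "inv_into UNIV \<pi> \<in> U" if "\<pi> \<in> U" for \<pi>
    proof -
      have \<pi>: "\<pi> permutes V" and inv: "\<And>M. M \<in> matchings l n \<Longrightarrow> S j (relabel \<pi> M) = S j M"
        using that by (auto simp: U_def)
      have "S j (relabel (inv_into UNIV \<pi>) M) = S j M" if "M \<in> matchings l n" for M
        using inv[OF rel[OF permutes_inv[OF \<pi>] that]] unfolding undo[OF \<pi>] by simp
      then show ?thesis using permutes_inv[OF \<pi>] by (simp add: U_def)
    qed
    show "\<rho> \<pi> j < f" if "\<pi> permutes V" for \<pi>
      using permutes_in_image[OF \<rho>(1)[OF that], of j] j by simp
    \<comment> \<open>Equal labels mean that \<open>\<pi>\<close> and \<open>\<sigma>\<close> carry
      \<open>S j\<close> to the same function, so that \<open>\<sigma>\<close> followed by the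
      inverse of \<open>\<pi>\<close> fixes it.\<close>
    show "inv_into UNIV \<pi> \<circ> \<sigma> \<in> U" if "\<pi> permutes V" "\<sigma> permutes V" "\<rho> \<pi> j = \<rho> \<sigma> j" for \<pi> \<sigma>
    proof -
      have p: "inv_into UNIV \<pi> \<circ> \<sigma> permutes V"
        using permutes_compose[OF that(2) permutes_inv[OF that(1)]] .
      have "S j (relabel (inv_into UNIV \<pi> \<circ> \<sigma>) M) = S j M" if M: "M \<in> matchings l n" for M
      proof -
        have "S j (relabel (inv_into UNIV \<pi> \<circ> \<sigma>) M) =
            S (\<rho> \<pi> j) (relabel \<pi> (relabel (inv_into UNIV \<pi> \<circ> \<sigma>) M))"
          using \<rho>(2)[OF \<open>\<pi> permutes V\<close> rel[OF p M]] by simp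
        also have "relabel \<pi> (relabel (inv_into UNIV \<pi> \<circ> \<sigma>) M) = relabel \<sigma> M"
          unfolding relabel_comp undo[OF \<open>\<pi> permutes V\<close>] ..
        finally show ?thesis using \<rho>(2)[OF \<open>\<sigma> permutes V\<close> M] \<open>\<rho> \<pi> j = \<rho> \<sigma> j\<close> by simp
      qed
      then show ?thesis using p by (simp add: U_def)
    qed
  qed
  have cV: "card V = n" by (simp add: V_def)
  obtain D where D: "D \<subseteq> V" "card (V - D) \<le> k" "alternating_on D"
    using alternating_off_few_points[of r k] assms(3-5) unfolding cV by blast
  have DW: "V - (V - D) = D" using D(1) by blast
  show ?thesis
  proof (rule that[of "V - D"])
    show "V - D \<subseteq> {1..n}" by (auto simp: V_def)
    show "card (V - D) \<le> k" by fact
    fix M a b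
    assume M: "M \<in> matchings l n" and "a \<in> {1..n} - (V - D)" "b \<in> {1..n} - (V - D)"
    then have ab: "a \<in> D" "b \<in> D" using DW by (auto simp: V_def)
    show "S j (relabel (Transposition.transpose a b) M) = S j M"
    proof (cases "a = b")
      case True then show ?thesis by simp
    next
      case False
      have m: "pairwise disjnt M" "\<And>e. e \<in> M \<Longrightarrow> card e = 2 \<and> e \<subseteq> V" "card (V - D) + 2 < card M"
        using M D(2) \<open>k + 2 < l\<close> by (auto simp: matchings_def edges_def V_def)
      obtain \<pi> where "\<pi> \<in> U" "relabel \<pi> M = relabel (Transposition.transpose a b) M"
        by (rule transpose_invariant[OF D(3,1) ab False m])
      then show ?thesis using M by (auto simp: U_def)
    qed
  qed
qed

section \<open>A parity inequality violated by the signed combination\<close>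

lemma two_card_matching:
  assumes "\<And>e. e \<in> N \<Longrightarrow> card e = 2" "pairwise disjnt N"
  shows "card (\<Union>N) = 2 * card N"
proof -
  have "finite e" if "e \<in> N" for e using assms(1)[OF that] by (metis card.infinite zero_neq_numeral)
  then have "card (\<Union>N) = sum card N" by (intro card_Union_disjoint assms(2))
  also have "\<dots> = (\<Sum>e\<in>N. 2)" using assms(1) by (rule sum.cong[OF refl])
  finally show ?thesis by simp
qed

lemma sum_char_vec: "finite H \<Longrightarrow> (\<Sum>e\<in>H. char_vec M e) = real (card (M \<inter> H))"
  by (simp add: char_vec_def sum.If_cases indicator_def Int_commute)

lemma match_polytope_sum_le:
  assumes "finite H" and H: "\<And>M. M \<in> matchings l n \<Longrightarrow> card (M \<inter> H) \<le> b" and x: "x \<in> match_polytope l n"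
  shows "(\<Sum>e\<in>H. x e) \<le> real b"
proof -
  have "convex {x :: nat set \<Rightarrow> real. (\<Sum>e\<in>H. x e) \<le> real b}"
  proof (rule convexI)
    fix x y :: "nat set \<Rightarrow> real" and u v :: real
    assume *: "x \<in> {x. (\<Sum>e\<in>H. x e) \<le> real b}" "y \<in> {x. (\<Sum>e\<in>H. x e) \<le> real b}"
      "0 \<le> u" "0 \<le> v" "u + v = 1"
    have "(\<Sum>e\<in>H. (u *\<^sub>R x + v *\<^sub>R y) e) = u * (\<Sum>e\<in>H. x e) + v * (\<Sum>e\<in>H. y e)"
      by (simp add: scaleR_fun_def sum.distrib sum_distrib_left)
    also have "\<dots> \<le> real b" using * by (intro convex_bound_le) auto
    finally show "u *\<^sub>R x + v *\<^sub>R y \<in> {x. (\<Sum>e\<in>H. x e) \<le> real b}" by simp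
  qed
  moreover have "char_vec ` matchings l n \<subseteq> {x. (\<Sum>e\<in>H. x e) \<le> real b}"
    using H sum_char_vec[OF assms(1)] by auto
  ultimately have "match_polytope l n \<subseteq> {x. (\<Sum>e\<in>H. x e) \<le> real b}"
    unfolding match_polytope_def by (rule hull_minimal[rotated])
  then show ?thesis using x by blast
qed

text \<open>The inequality behind the contradiction bounds the number of edges in \<open>H\<close>,
  which consists of \<open>R\<close> and all edges inside \<open>A\<close> or inside
  \<open>B\<close>. By parity a matching of size \<open>l\<close> has at most \<open>l - 1\<close>
  edges in \<open>H\<close>. The signed combination attains \<open>l\<close>, because its weighted
  number of crossing edges is 0.\<close>

lemma violating_combination:
  fixes S :: "nat \<Rightarrow> nat set set \<Rightarrow> real"
  assumes sym: "\<And>\<pi>. \<pi> permutes {1..n} \<Longrightarrow> \<exists>\<rho>. \<rho> permutes {..<f} \<and>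
      (\<forall>i<f. \<forall>M\<in>matchings l n. S (\<rho> i) (relabel \<pi> M) = S i M)"
    and nonneg: "\<And>j M. j < f \<Longrightarrow> M \<in> matchings l n \<Longrightarrow> S j M \<ge> 0"
    and f: "f < 2 ^ Suc r" "12 * r + 2 \<le> n" "f < n choose Suc k"
    and k: "0 < k" "2 * k + 3 \<le> l" "2 * l \<le> n"
  shows "\<exists>P R w. finite P \<and> (\<forall>N\<in>P. R \<union> N \<in> matchings l n) \<and> (\<Sum>N\<in>P. w N) = (1::real) \<and>
    (\<forall>j<f. 0 \<le> (\<Sum>N\<in>P. w N * S j (R \<union> N))) \<and>
    (\<lambda>e. \<Sum>N\<in>P. w N * char_vec (R \<union> N) e) \<notin> match_polytope l n"
proof -
  define m where "m = 2 * k + 1"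
  define A B :: "nat set" where "A = {1..m}" and "B = {m+1..2*m}"
  interpret odd_halves A B k by unfold_locales (auto simp: A_def B_def m_def)
  \<comment> \<open>These \<open>l - m\<close> edges pair consecutive nodes beyond
    \<open>A \<union> B\<close>; the last one is \<open>{2 * l - 1, 2 * l}\<close>, which lies in
    \<open>{1..n}\<close> by \<open>2 * l \<le> n\<close>.\<close>
  define R where "R = (\<lambda>i. {2 * i + 1, 2 * i + 2}) ` {m..<l}"
  define P where "P = {N. perfect_matching (A \<union> B) N}"
  have finP: "finite P" unfolding P_def using finite_perfect_matchings[of "A \<union> B"] fin by simp
  have R_edge: "card e = 2 \<and> e \<subseteq> {2*m+1..n}" if "e \<in> R" for e
    using that k by (auto simp: R_def m_def)
  have R_disj: "pairwise disjnt R"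
  proof -
    have "{2 * i + 1, 2 * i + 2} \<inter> {2 * j + 1, 2 * j + 2} = {}" if "i \<noteq> j" for i j :: nat
      using that by (simp add: disjoint_iff)
    then have "disjnt {2 * i + 1, 2 * i + 2} {2 * j + 1, 2 * j + 2}" if "i \<noteq> j" for i j :: nat
      using that by (simp add: disjnt_def)
    then show ?thesis unfolding R_def by (intro pairwise_imageI) simp
  qed
  have R_card: "card R = l - m"
    unfolding R_def by (subst card_image) (simp_all add: inj_on_def doubleton_eq_iff)
  have AB_sub: "A \<union> B = {1..2*m}" by (auto simp: A_def B_def)
  have R_off: "\<Union>R \<inter> (A \<union> B) = {}"
  proof -
    have "\<Union>R \<subseteq> {2*m+1..n}" using R_edge by blast
    moreover have "{2*m+1..n} \<inter> {1..2*m} = {}" by auto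
    ultimately show ?thesis unfolding AB_sub by blast
  qed
  have m_n: "2 * m \<le> n" using k by (simp add: m_def)
  have RN: "R \<union> N \<in> matchings l n" "R \<inter> N = {}" "card N = m"
      "\<And>e. e \<in> N \<Longrightarrow> card e = 2 \<and> e \<subseteq> A \<union> B" "finite N" if "N \<in> P" for N
  proof -
    have p: "\<And>e. e \<in> N \<Longrightarrow> card e = 2" "pairwise disjnt N" "\<Union>N = A \<union> B"
      using that by (auto simp: P_def perfect_matching_def)
    show e: "card e = 2 \<and> e \<subseteq> A \<union> B" if "e \<in> N" for e using p that by auto
    show finN: "finite N" using finite_perfect_matching[of "A \<union> B" N] fin that by (simp add: P_def)
    have "2 * card N = 2 * m" using two_card_matching[OF p(1,2)] by (simp add: p(3) AB_sub)
    then show cN: "card N = m" by simp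
    have off: "e \<inter> e' = {}" if "e \<in> R" "e' \<in> N" for e e' using that e R_off by blast
    then show RN: "R \<inter> N = {}" using p(1) by (metis Int_absorb card.empty disjoint_iff zero_neq_numeral)
    have "e' \<inter> e = {}" if "e \<in> R" "e' \<in> N" for e e' using off[OF that] by blast
    then have "pairwise disjnt (R \<union> N)"
      using R_disj p(2) off unfolding pairwise_def disjnt_def by (simp add: ball_Un)
    moreover have "R \<union> N \<subseteq> edges n"
    proof
      fix x assume "x \<in> R \<union> N"
      then have "card x = 2" "x \<subseteq> {2*m+1..n} \<or> x \<subseteq> {1..2*m}" using R_edge e AB_sub by auto
      moreover have "{2*m+1..n} \<subseteq> {1..n}" "{1..2*m} \<subseteq> {1..n}" using m_n by auto
      ultimately show "x \<in> edges n" unfolding edges_def by blast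
    qed
    moreover have "card (R \<union> N) = l"
      using RN finN cN R_card k by (subst card_Un_disjoint) (auto simp: R_def m_def)
    ultimately show "R \<union> N \<in> matchings l n" by (simp add: matchings_def)
  qed
  obtain w where w: "(\<Sum>N | perfect_matching (A \<union> B) N. w N) = 1"
    "(\<Sum>N | perfect_matching (A \<union> B) N. w N * real (edge_type A N 1)) = 0"
    "\<forall>C. (\<forall>e\<in>C. card e = 2) \<longrightarrow> pairwise disjnt C \<longrightarrow> \<Union>C \<subseteq> A \<union> B \<longrightarrow> card C \<le> k \<longrightarrow>
      0 \<le> (\<Sum>N | perfect_matching (A \<union> B) N \<and> C \<subseteq> N. w N)"
    using signed_weights[OF k(1)] by (elim exE conjE) (rule that; assumption)
  define H where "H = R \<union> {e \<in> edges n. e \<subseteq> A} \<union> {e \<in> edges n. e \<subseteq> B}"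
  have fin_edges: "finite (edges n)"
    by (rule finite_subset[of _ "Pow {1..n}"]) (auto simp: edges_def)
  have finH: "finite H" using fin_edges by (simp add: H_def R_def)
  have half: "card (M \<inter> {e \<in> edges n. e \<subseteq> X}) \<le> k"
    if M: "M \<in> matchings l n" and X: "finite X" "card X = m" for M X
  proof -
    let ?N = "M \<inter> {e \<in> edges n. e \<subseteq> X}"
    have "pairwise disjnt M" using M by (simp add: matchings_def)
    then have "pairwise disjnt ?N" by (rule pairwise_subset) blast
    then have "card (\<Union>?N) = 2 * card ?N"
      by (intro two_card_matching) (simp_all add: edges_def)
    moreover have "card (\<Union>?N) \<le> card X" using X(1) by (rule card_mono) blast
    ultimately show ?thesis using X(2) by (simp add: m_def)
  qed
  have H_bound: "card (M \<inter> H) \<le> l - 1" if M: "M \<in> matchings l n" for M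
  proof -
    have "M \<inter> H \<subseteq> R \<union> (M \<inter> {e \<in> edges n. e \<subseteq> A}) \<union> (M \<inter> {e \<in> edges n. e \<subseteq> B})"
      by (auto simp: H_def)
    then have "card (M \<inter> H) \<le> card (R \<union> (M \<inter> {e \<in> edges n. e \<subseteq> A}) \<union> (M \<inter> {e \<in> edges n. e \<subseteq> B}))"
      using fin_edges by (intro card_mono) (auto simp: R_def)
    also have "\<dots> \<le> card R + card (M \<inter> {e \<in> edges n. e \<subseteq> A}) + card (M \<inter> {e \<in> edges n. e \<subseteq> B})"
      by (intro order_trans[OF card_Un_le] add_mono) auto
    \<comment> \<open>An odd side of \<open>2 * k + 1\<close> nodes has room for \<open>k\<close>
      disjoint edges only, and the total is \<open>l - 1\<close>.\<close>
    also have "\<dots> \<le> (l - m) + k + k"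
      using half[OF M, of A] half[OF M, of B] by (simp add: R_card A_def B_def)
    finally show ?thesis using k by (simp add: m_def)
  qed
  have facet: "(\<Sum>e\<in>H. x e) \<le> real (l - 1)" if "x \<in> match_polytope l n" for x
    by (rule match_polytope_sum_le[OF finH H_bound that])
  have count: "real (card ((R \<union> N) \<inter> H)) = real l - real (edge_type A N 1)" if N: "N \<in> P" for N
  proof -
    have crossing: "e \<in> H \<longleftrightarrow> card (e \<inter> A) \<noteq> 1" if e: "e \<in> N" for e
    proof -
      have e': "card e = 2" "e \<subseteq> A \<union> B" "e \<notin> R" using RN[OF N] e by auto
      then obtain u v where uv: "e = {u, v}" "u \<noteq> v" by (auto simp: card_2_iff)
      have "e \<in> edges n" using RN(1)[OF N] e by (auto simp: matchings_def)
      then have "e \<in> H \<longleftrightarrow> e \<subseteq> A \<or> e \<subseteq> B" using e' by (auto simp: H_def)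
      moreover have "card (e \<inter> A) \<noteq> 1 \<longleftrightarrow> e \<subseteq> A \<or> e \<subseteq> B"
        using uv e'(2) AB by (cases "u \<in> A"; cases "v \<in> A") (auto simp: Int_insert_left)
      ultimately show ?thesis by simp
    qed
    let ?X = "{e \<in> N. card (e \<inter> A) = 1}"
    have "(R \<union> N) \<inter> H = (R \<union> N) - ?X"
      using crossing RN(2)[OF N] by (auto simp: H_def)
    moreover have "card ((R \<union> N) - ?X) = card (R \<union> N) - card ?X"
      using RN(5)[OF N] by (intro card_Diff_subset) auto
    moreover have "card (R \<union> N) = l" using RN(1)[OF N] by (simp add: matchings_def)
    moreover have "card ?X \<le> card (R \<union> N)"
      using RN(5)[OF N] by (intro card_mono) (auto simp: R_def)
    ultimately show ?thesis by (simp add: edge_type_def of_nat_diff)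
  qed
  show ?thesis
  proof (rule exI[of _ P], rule exI[of _ R], rule exI[of _ w], intro conjI ballI allI impI)
    show "finite P" by fact
    show "R \<union> N \<in> matchings l n" if "N \<in> P" for N using RN(1)[OF that] .
    show "(\<Sum>N\<in>P. w N) = 1" using w(1) by (simp add: P_def)
    show "0 \<le> (\<Sum>N\<in>P. w N * S j (R \<union> N))" if j: "j < f" for j
    proof -
      obtain W where W: "W \<subseteq> {1..n}" "card W \<le> k"
        and inv: "\<And>M a b. M \<in> matchings l n \<Longrightarrow> a \<in> {1..n} - W \<Longrightarrow> b \<in> {1..n} - W \<Longrightarrow>
          S j (relabel (Transposition.transpose a b) M) = S j M"
        by (rule alternating_stabilizer[where l = l and S = S and r = r]) (use sym j f k in auto)
      have Z: "A \<union> B - W \<subseteq> {1..n} - W" unfolding AB_sub using m_n by auto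
      show ?thesis
        unfolding P_def
      proof (rule signed_sum_nonneg[OF _ _ W(2) R_off, where \<M> = "matchings l n"])
        show "0 \<le> (\<Sum>N | perfect_matching (A \<union> B) N \<and> C \<subseteq> N. w N)"
          if "\<And>e. e \<in> C \<Longrightarrow> card e = 2" "pairwise disjnt C" "\<Union>C \<subseteq> A \<union> B" "card C \<le> k" for C
          using w(3) that by simp
        show "finite W" using W(1) finite_subset by blast
        show "R \<union> N \<in> matchings l n" if "perfect_matching (A \<union> B) N" for N
          using RN(1) that by (simp add: P_def)
        show "0 \<le> S j M" if "M \<in> matchings l n" for M using nonneg[OF j that] .
        show "relabel (Transposition.transpose a b) M \<in> matchings l n \<and>
            S j (relabel (Transposition.transpose a b) M) = S j M"
          if M: "M \<in> matchings l n" and ab: "a \<in> A \<union> B - W" "b \<in> A \<union> B - W" for M a b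
        proof -
          have ab': "a \<in> {1..n} - W" "b \<in> {1..n} - W" using Z ab by blast+
          then have "Transposition.transpose a b permutes {1..n}" by (intro permutes_swap_id) auto
          then show ?thesis using relabel_matchings[OF _ M] inv[OF M ab'] by blast
        qed
      qed
    qed
    show "(\<lambda>e. \<Sum>N\<in>P. w N * char_vec (R \<union> N) e) \<notin> match_polytope l n"
    proof
      assume "(\<lambda>e. \<Sum>N\<in>P. w N * char_vec (R \<union> N) e) \<in> match_polytope l n"
      then have "(\<Sum>e\<in>H. \<Sum>N\<in>P. w N * char_vec (R \<union> N) e) \<le> real (l - 1)" by (rule facet)
      moreover have "(\<Sum>e\<in>H. \<Sum>N\<in>P. w N * char_vec (R \<union> N) e) = (\<Sum>N\<in>P. w N * (\<Sum>e\<in>H. char_vec (R \<union> N) e))"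
        by (subst sum.swap) (simp add: sum_distrib_left)
      moreover have "\<dots> = (\<Sum>N\<in>P. w N * (real l - real (edge_type A N 1)))"
      proof (intro sum.cong refl arg_cong2[of _ _ _ _ times])
        fix N assume "N \<in> P"
        then show "(\<Sum>e\<in>H. char_vec (R \<union> N) e) = real l - real (edge_type A N 1)"
          unfolding sum_char_vec[OF finH] by (rule count)
      qed
      moreover have "\<dots> = (\<Sum>N\<in>P. w N) * real l - (\<Sum>N\<in>P. w N * real (edge_type A N 1))"
        by (simp add: right_diff_distrib sum_subtractf sum_distrib_right)
      moreover have "\<dots> = real l" using w(1,2) by (simp add: P_def)
      ultimately show False using k by simp
    qed
  qed
qed

text \<open>Averaging the slack of row \<open>j\<close> over the fibre \<open>T M\<close> yields a
  function of \<open>M\<close> alone, and node permutations permute these functions along with the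
  rows. The signed combination of matchings then lifts to an affine combination of
  solutions.\<close>

theorem symmetric_formulation_size:
  assumes ef: "extended_formulation (edges n) (match_polytope l n) F"
    and sym: "symmetric_formulation (edges n) (node_group n) F"
    and r: "12 * r + 2 \<le> n" and k: "0 < k" "2 * k + 3 \<le> l" "2 * l \<le> n"
  shows "form_size F \<ge> min (2 ^ Suc r) (n choose Suc k)"
proof (rule ccontr)
  assume "\<not> min (2 ^ Suc r) (n choose Suc k) \<le> form_size F"
  then have f: "form_size F < 2 ^ Suc r" "form_size F < n choose Suc k" by auto
  have wf: "well_formed (edges n) F" and proj: "projection (edges n) F ` solutions F = match_polytope l n"
    using ef by (auto simp: extended_formulation_def)
  obtain T where T': "\<forall>M\<in>matchings l n. finite (T M) \<and> T M \<noteq> {}"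
    "\<forall>M\<in>matchings l n. \<forall>y\<in>T M. y \<in> solutions F \<and> projection (edges n) F y = char_vec M"
    and T_sym: "\<forall>\<pi>. \<pi> permutes {1..n} \<longrightarrow> (\<exists>\<kappa> \<rho>. \<rho> permutes {..<form_size F} \<and>
       (\<forall>M\<in>matchings l n. bij_betw (permute_vec \<kappa>) (T M) (T (relabel \<pi> M))) \<and>
       (\<forall>j<form_size F. \<forall>y\<in>solutions F. slack F (\<rho> j) (permute_vec \<kappa> y) = slack F j y))"
    using equivariant_fibers[OF ef sym] by (elim exE conjE) (rule that; assumption)
  have T: "\<And>M. M \<in> matchings l n \<Longrightarrow> finite (T M) \<and> T M \<noteq> {}"
    "\<And>M y. M \<in> matchings l n \<Longrightarrow> y \<in> T M \<Longrightarrow> y \<in> solutions F \<and> projection (edges n) F y = char_vec M"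
    using T' by auto
  define S where "S j M = (\<Sum>y\<in>T M. slack F j y) / real (card (T M))" for j M
  have S_sym: "\<exists>\<rho>. \<rho> permutes {..<form_size F} \<and>
      (\<forall>i<form_size F. \<forall>M\<in>matchings l n. S (\<rho> i) (relabel \<pi> M) = S i M)" if \<pi>: "\<pi> permutes {1..n}" for \<pi>
  proof -
    obtain \<kappa> \<rho> where \<rho>: "\<rho> permutes {..<form_size F}"
      and b: "\<And>M. M \<in> matchings l n \<Longrightarrow> bij_betw (permute_vec \<kappa>) (T M) (T (relabel \<pi> M))"
      and s: "\<And>j y. j < form_size F \<Longrightarrow> y \<in> solutions F \<Longrightarrow> slack F (\<rho> j) (permute_vec \<kappa> y) = slack F j y"
      using T_sym[rule_format, OF \<pi>] by blast
    have "S (\<rho> i) (relabel \<pi> M) = S i M" if i: "i < form_size F" and M: "M \<in> matchings l n" for i M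
    proof -
      have "(\<Sum>y\<in>T (relabel \<pi> M). slack F (\<rho> i) y) = (\<Sum>y\<in>T M. slack F (\<rho> i) (permute_vec \<kappa> y))"
        by (rule sum.reindex_bij_betw[OF b[OF M], symmetric])
      also have "\<dots> = (\<Sum>y\<in>T M. slack F i y)" using s[OF i] T(2)[OF M] by (intro sum.cong) auto
      finally show ?thesis using bij_betw_same_card[OF b[OF M]] by (simp add: S_def)
    qed
    then show ?thesis using \<rho> by blast
  qed
  have S_nonneg: "S j M \<ge> 0" if "j < form_size F" "M \<in> matchings l n" for j M
    using T(2)[OF that(2)] solutions_iff[OF wf] that(1) by (auto simp: S_def intro!: divide_nonneg_nonneg sum_nonneg)
  have "\<exists>P R w. finite P \<and> (\<forall>N\<in>P. R \<union> N \<in> matchings l n) \<and> (\<Sum>N\<in>P. w N) = (1::real) \<and>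
    (\<forall>j<form_size F. 0 \<le> (\<Sum>N\<in>P. w N * S j (R \<union> N))) \<and>
    (\<lambda>e. \<Sum>N\<in>P. w N * char_vec (R \<union> N) e) \<notin> match_polytope l n"
    by (rule violating_combination[where r = r and k = k]) (fact S_sym S_nonneg f r k)+
  then obtain P R w where P': "finite P" "\<forall>N\<in>P. R \<union> N \<in> matchings l n" "(\<Sum>N\<in>P. w N) = (1::real)"
    "\<forall>j<form_size F. 0 \<le> (\<Sum>N\<in>P. w N * S j (R \<union> N))"
    "(\<lambda>e. \<Sum>N\<in>P. w N * char_vec (R \<union> N) e) \<notin> match_polytope l n"
    by (elim exE conjE) (rule that; assumption)
  note P = P'(1) P'(2)[rule_format] P'(3) P'(4)[rule_format] P'(5)
  define \<Omega> where "\<Omega> = (SIGMA N:P. T (R \<union> N))"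
  \<comment> \<open>The weight of a matching is shared equally by the solutions in its fibre, which
    turns sums over \<open>\<Omega>\<close> into weighted sums of fibre averages.\<close>
  define v where "v = (\<lambda>(N, y :: real vec). w N / real (card (T (R \<union> N))))"
  have fin: "finite \<Omega>" unfolding \<Omega>_def using P(1,2) T(1) by (intro finite_SigmaI) auto
  have avg: "(\<Sum>i\<in>\<Omega>. v i * h (snd i)) = (\<Sum>N\<in>P. w N * ((\<Sum>y\<in>T (R \<union> N). h y) / real (card (T (R \<union> N)))))" for h
  proof -
    have "(\<Sum>i\<in>\<Omega>. v i * h (snd i)) = (\<Sum>N\<in>P. \<Sum>y\<in>T (R \<union> N). v (N, y) * h y)"
      unfolding \<Omega>_def using P(1,2) T(1) by (subst sum.Sigma) (auto simp: case_prod_unfold)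
    then show ?thesis by (simp add: v_def sum_distrib_left[symmetric] sum_divide_distrib[symmetric])
  qed
  have card_T: "real (card (T (R \<union> N))) \<noteq> 0" if "N \<in> P" for N using T(1)[OF P(2)[OF that]] by simp
  have const: "(\<Sum>y\<in>T (R \<union> N). h y) / real (card (T (R \<union> N))) = c"
    if "N \<in> P" "\<And>y. y \<in> T (R \<union> N) \<Longrightarrow> h y = c" for N c and h :: "real vec \<Rightarrow> real"
    using card_T[OF that(1)] that(2) by simp
  have "(\<lambda>e. \<Sum>i\<in>\<Omega>. v i * projection (edges n) F (snd i) e) \<in> projection (edges n) F ` solutions F"
  proof (rule affine_combination_solution[OF wf fin])
    show "snd i \<in> solutions F" if "i \<in> \<Omega>" for i using that T(2)[OF P(2)] by (auto simp: \<Omega>_def)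
    have "(\<Sum>i\<in>\<Omega>. v i) = (\<Sum>N\<in>P. w N * ((\<Sum>y\<in>T (R \<union> N). 1) / real (card (T (R \<union> N)))))"
      using avg[of "\<lambda>y. 1"] by simp
    also have "\<dots> = (\<Sum>N\<in>P. w N)"
      by (intro sum.cong refl) (simp only: const[OF _ refl] mult_1_right)
    finally show "(\<Sum>i\<in>\<Omega>. v i) = 1" using P(3) by simp
    show "0 \<le> (\<Sum>i\<in>\<Omega>. v i * slack F j (snd i))" if "j < form_size F" for j
      unfolding avg using P(4)[OF that] by (simp add: S_def)
  qed
  moreover have "(\<Sum>i\<in>\<Omega>. v i * projection (edges n) F (snd i) e) = (\<Sum>N\<in>P. w N * char_vec (R \<union> N) e)" for e
    unfolding avg[of "\<lambda>y. projection (edges n) F y e"]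
    using T(2)[OF P(2)] by (intro sum.cong refl arg_cong2[of _ _ _ _ times] const) auto
  ultimately show False using P(5) proj by simp
qed

section \<open>Polynomial size bounds and the choice of the number of nodes\<close>

text \<open>For fixed \<open>c\<close> this is a polynomial in \<open>x\<close>, bounded by
  \<open>C * x ^ K\<close>; one further power of \<open>x\<close> absorbs \<open>C\<close>. Holding
  for all large exponents, the bounds for several \<open>c\<close> can be merged into one.\<close>

lemma bivariate_poly_bound:
  fixes q :: "real poly poly"
  shows "\<exists>K0. \<forall>K\<ge>K0. \<forall>x\<ge>real K. \<bar>poly (poly q [:x:]) c\<bar> \<le> x ^ K"
proof -
  have "\<exists>C K. C \<ge> 0 \<and> (\<forall>x\<ge>1. \<bar>poly (poly q [:x:]) c\<bar> \<le> C * x ^ K)"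
  proof (induction q)
    case 0 then show ?case by (intro exI[of _ 0]) simp
  next
    case (pCons a q)
    then obtain C K where C: "C \<ge> 0" "\<And>x. x \<ge> 1 \<Longrightarrow> \<bar>poly (poly q [:x:]) c\<bar> \<le> C * x ^ K" by blast
    have "\<bar>poly (poly (pCons a q) [:x:]) c\<bar> \<le> (\<bar>poly a c\<bar> + C) * x ^ Suc K" if x: "x \<ge> 1" for x
    proof -
      have "\<bar>poly (poly (pCons a q) [:x:]) c\<bar> \<le> \<bar>poly a c\<bar> + x * \<bar>poly (poly q [:x:]) c\<bar>"
        using x abs_triangle_ineq[of "poly a c" "x * poly (poly q [:x:]) c"] by (simp add: abs_mult)
      also have "\<dots> \<le> \<bar>poly a c\<bar> * x ^ Suc K + x * (C * x ^ K)"
        using x C(2)[OF x] by (intro add_mono mult_left_mono mult_le_cancel_left1[THEN iffD2])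
          (auto intro: one_le_power mult_ge1_I simp: mult_le_cancel_left1)
      finally show ?thesis by (simp add: algebra_simps)
    qed
    then show ?case using C(1) by (intro exI[of _ "\<bar>poly a c\<bar> + C"] exI[of _ "Suc K"]) auto
  qed
  then obtain C K where C: "C \<ge> 0" "\<And>x. x \<ge> 1 \<Longrightarrow> \<bar>poly (poly q [:x:]) c\<bar> \<le> C * x ^ K" by blast
  have "\<bar>poly (poly q [:x:]) c\<bar> \<le> x ^ K'" if K': "K' \<ge> max (nat \<lceil>C\<rceil>) (Suc K)" and x: "x \<ge> real K'" for K' x
  proof -
    have x1: "x \<ge> 1" and xC: "C \<le> x" using K' x by linarith+
    have "\<bar>poly (poly q [:x:]) c\<bar> \<le> C * x ^ K" using C(2) x1 by simp
    also have "\<dots> \<le> x * x ^ K" using xC x1 by (intro mult_right_mono) auto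
    also have "\<dots> = x ^ Suc K" by simp
    also have "\<dots> \<le> x ^ K'" using K' x1 by (intro power_increasing) auto
    finally show ?thesis .
  qed
  then show ?thesis by blast
qed

lemma card_edges_bounds:
  assumes "4 \<le> n"
  shows "n \<le> card (edges n)" "card (edges n) \<le> n ^ 2"
proof -
  have c: "card (edges n) = n choose 2" unfolding edges_def using n_subsets[of "{1..n}" 2] by simp
  show "n \<le> card (edges n)" unfolding c using binomial_mono[of 1 2 n] assms by simp
  show "card (edges n) \<le> n ^ 2" unfolding c using assms by (intro binomial_le_pow) simp
qed

text \<open>Vertices are characteristic vectors with entries 0 and 1. The inner variable of the
  bounding polynomial thus takes only three values, and the size is polynomially bounded in the
  number of edges.\<close>

lemma vertex_encoding_length_match:
  "vertex_encoding_length (edges n) (match_polytope l n) \<in> {0, encoding_length 0, encoding_length 1}"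
proof -
  let ?X = "{encoding_length (v e) | v e. v extreme_point_of match_polytope l n \<and> e \<in> edges n}"
  have sub: "?X \<subseteq> {encoding_length 0, encoding_length 1}"
    unfolding match_polytope_def
    by (auto dest!: extreme_point_of_convex_hull simp: char_vec_def indicator_def)
  have "finite (insert 0 ?X)" "insert 0 ?X \<subseteq> {0, encoding_length 0, encoding_length 1}"
    using finite_subset[OF sub] sub by auto
  then show ?thesis unfolding vertex_encoding_length_def using Max_in[of "insert 0 ?X"] by blast
qed

theorem corollary18:
  fixes l :: "nat \<Rightarrow> nat" and n0 :: nat and c :: real
  assumes "c > 0"
    and "\<forall>n\<ge>n0. c * ln (real n) \<le> real (l n) \<and> real (l n) \<le> real n / 2"
  shows "\<not> (\<exists>F :: nat \<Rightarrow> nat set formulation.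
    compact_family {n0..} edges (\<lambda>n. match_polytope (l n) n) F \<and>
    (\<forall>n\<ge>n0. symmetric_formulation (edges n) (node_group n) (F n)))"
proof
  assume "\<exists>F :: nat \<Rightarrow> nat set formulation.
    compact_family {n0..} edges (\<lambda>n. match_polytope (l n) n) F \<and>
    (\<forall>n\<ge>n0. symmetric_formulation (edges n) (node_group n) (F n))"
  then obtain F :: "nat \<Rightarrow> nat set formulation" where
    compact: "compact_family {n0..} edges (\<lambda>n. match_polytope (l n) n) F"
    and sym: "\<And>n. n \<ge> n0 \<Longrightarrow> symmetric_formulation (edges n) (node_group n) (F n)" by blast
  obtain q :: "real poly poly" where
    ef: "\<And>n. n \<ge> n0 \<Longrightarrow> extended_formulation (edges n) (match_polytope (l n) n) (F n)" and
    q: "\<And>n. n \<ge> n0 \<Longrightarrow> real (form_size (F n)) \<le>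
      poly (poly q [:real (card (edges n)):]) (real (vertex_encoding_length (edges n) (match_polytope (l n) n)))"
    using compact unfolding compact_family_def Let_def by auto
  have "\<exists>K0. \<forall>c. \<forall>K\<ge>K0 c. \<forall>x\<ge>real K. \<bar>poly (poly q [:x:]) c\<bar> \<le> x ^ K"
    using bivariate_poly_bound[of q] by metis
  then obtain K0 where K0: "\<And>c K x. K \<ge> K0 c \<Longrightarrow> x \<ge> real K \<Longrightarrow> \<bar>poly (poly q [:x:]) c\<bar> \<le> x ^ K" by blast
  \<comment> \<open>The sum dominates the thresholds of all three encoding lengths; the successor
    makes the \<open>k\<close> below positive.\<close>
  define K where "K = Suc (K0 0 + K0 (real (encoding_length 0)) + K0 (real (encoding_length 1)))"
  have size: "form_size (F n) \<le> n ^ (2 * K)" if n: "n \<ge> n0" "n \<ge> 4" "n \<ge> K" for n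
  proof -
    let ?e = "vertex_encoding_length (edges n) (match_polytope (l n) n)"
    have "K0 (real ?e) \<le> K" using vertex_encoding_length_match[of n "l n"] by (auto simp: K_def)
    moreover have "real K \<le> real (card (edges n))" using card_edges_bounds(1)[OF n(2)] n(3) by linarith
    ultimately have "\<bar>poly (poly q [:real (card (edges n)):]) (real ?e)\<bar> \<le> real (card (edges n)) ^ K"
      by (rule K0)
    then have "real (form_size (F n)) \<le> real (card (edges n)) ^ K" using q[OF n(1)] by linarith
    also have "\<dots> \<le> real (n ^ 2) ^ K"
      using card_edges_bounds(2)[OF n(2)] by (intro power_mono) (auto simp del: of_nat_power)
    finally have "real (form_size (F n)) \<le> real (n ^ (2 * K))" by (simp add: power_mult)
    then show ?thesis by linarith
  qed
  define k where "k = 2 * K"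
  \<comment> \<open>With \<open>n = 2 ^ s\<close> and \<open>r = k * s\<close> the conditions say in
    turn: \<open>n\<close> is in the range of the hypothesis; the size and binomial estimates apply;
    \<open>12 * r + 2 \<le> n\<close>; \<open>n ^ k\<close> is below the binomial coefficient; the
    matchings have at least \<open>2 * k + 3\<close> edges.\<close>
  have "eventually (\<lambda>s::nat. real n0 \<le> 2 ^ s) at_top" by real_asymp
  moreover have "eventually (\<lambda>s::nat. 4 + real K + 2 * (real k + 1) \<le> 2 ^ s) at_top" by real_asymp
  moreover have "eventually (\<lambda>s::nat. 12 * (real k * real s) + 2 \<le> 2 ^ s) at_top" by real_asymp
  moreover have "eventually (\<lambda>s::nat. (real k + 1) ^ (k + 1) < 2 ^ s) at_top" by real_asymp
  moreover have "eventually (\<lambda>s::nat. 2 * real k + 3 \<le> c * (real s * ln 2)) at_top"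
    using assms(1) by real_asymp
  ultimately have "eventually (\<lambda>s::nat. real n0 \<le> 2 ^ s \<and> 4 + real K + 2 * (real k + 1) \<le> 2 ^ s \<and>
    12 * (real k * real s) + 2 \<le> 2 ^ s \<and> (real k + 1) ^ (k + 1) < 2 ^ s \<and>
    2 * real k + 3 \<le> c * (real s * ln 2)) at_top" by eventually_elim simp
  then obtain s :: nat where s: "real n0 \<le> 2 ^ s" "4 + real K + 2 * (real k + 1) \<le> 2 ^ s"
    "12 * (real k * real s) + 2 \<le> 2 ^ s" "(real k + 1) ^ (k + 1) < 2 ^ s" "2 * real k + 3 \<le> c * (real s * ln 2)"
    by (auto simp: eventually_at_top_linorder)
  \<comment> \<open>A power of two makes \<open>n ^ k\<close> equal to \<open>2 ^ (k * s)\<close>,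
    so that \<open>r\<close> is the integer \<open>k * s\<close> without rounding of
    logarithms.\<close>
  define n :: nat where "n = 2 ^ s"
  have n: "real n = 2 ^ s" by (simp add: n_def)
  have "real (4 + K + 2 * (k + 1)) \<le> real n" using s(2) by (simp add: n)
  then have "4 + K + 2 * (k + 1) \<le> n" by (simp only: of_nat_le_iff)
  moreover have "n0 \<le> n" using s(1) unfolding n[symmetric] by linarith
  ultimately have n_ge: "n \<ge> n0" "n \<ge> 4" "n \<ge> K" "2 * Suc k \<le> n" by simp_all
  have "real (12 * (k * s) + 2) \<le> real n" using s(3) by (simp add: n)
  then have "12 * (k * s) + 2 \<le> n" by (simp only: of_nat_le_iff)
  note n_ge = n_ge this
  have ln_n: "ln (real n) = real s * ln 2" unfolding n by (simp add: ln_realpow)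
  have "2 * real k + 3 \<le> real (l n)" "real (l n) \<le> real n / 2"
    using assms(2)[rule_format, OF n_ge(1)] s(5) unfolding ln_n by auto
  then have l: "2 * k + 3 \<le> l n" "2 * l n \<le> n" by linarith+
  have size_n: "form_size (F n) \<le> n ^ k" using size n_ge unfolding k_def by blast
  have "form_size (F n) < 2 ^ Suc (k * s)"
  proof -
    have "n ^ k = 2 ^ (k * s)" by (simp add: n_def power_mult[symmetric] mult.commute)
    then show ?thesis using size_n by (simp add: le_less_trans)
  qed
  moreover have "form_size (F n) < n choose Suc k"
  proof -
    \<comment> \<open>The estimate \<open>n choose Suc k \<ge> (n / Suc k) ^ Suc k\<close> has one
      more factor \<open>n\<close> than the size bound, which outweighs the constant
      \<open>Suc k ^ Suc k\<close>.\<close>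
    have "real n ^ k * (real k + 1) ^ (k + 1) < real n ^ k * real n"
      using s(4) n_ge(2) unfolding n[symmetric] by (intro mult_strict_left_mono) auto
    then have "real n ^ k < real n ^ k * real n / (real k + 1) ^ (k + 1)"
      by (subst pos_less_divide_eq) auto
    also have "\<dots> = (real n / real (Suc k)) ^ Suc k"
      by (simp only: power_divide power_Suc2 of_nat_Suc Suc_eq_plus1[symmetric] add.commute[of 1]
          times_divide_times_eq)
    also have "\<dots> \<le> real (n choose Suc k)" using n_ge(4) by (intro binomial_ge_n_over_k_pow_k) simp
    finally have "n ^ k < n choose Suc k" by (simp flip: of_nat_power)
    then show ?thesis using size_n by linarith
  qed
  moreover have "form_size (F n) \<ge> min (2 ^ Suc (k * s)) (n choose Suc k)"
    by (rule symmetric_formulation_size[OF ef[OF n_ge(1)] sym[OF n_ge(1)] n_ge(5) _ l])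
      (simp add: k_def K_def)
  ultimately show False by linarith
qed

end
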